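(* Let $R$ be a commutative ring and let $V$ be an $\mathrm{FI}$-module over $R$. Then for every $a\in\mathbb{N}$ there is an isomorphism of $\mathrm{FI}$-modules \[ H^{\mathrm{FI}}_a(V)\;\cong\; H_a(\widetilde{S}_{-*}V). \]
   Context: Let $R$ be a commutative ring. $\mathrm{FI}$ denotes the category of finite sets and injective maps; an $\mathrm{FI}$-module is a covariant functor from $\mathrm{FI}$ to the category of $R$-modules. For $n\in\mathbb{N}$, $[n]=\{1,\dots,n\}$ (so $[0]=\emptyset$). Let $A=\bigoplus_{0\le m\le n}A_{m,n}$, where $A_{m,n}$ is the free $R$-module on $\mathrm{Hom}_{\mathrm{FI}}([m],[n])$, made into a non-unital $R$-algebra by setting, for $\alpha\in\mathrm{Hom}_{\mathrm{FI}}([m],[n])$ and $\beta\in\mathrm{Hom}_{\mathrm{FI}}([r],[s])$, $\alpha\beta=\alpha\circ\beta$ if $s=m$ and $\alpha\beta=0$ otherwise. Let $J=\bigoplus_{0\le m<n}A_{m,n}$, a two-sided ideal, and let $e_n\in A_{n,n}$ be the identity of $[n]$. A left $A$-module $M$ is graded if $M=\bigoplus_n e_nM$. The functor $V\mapsto\bigoplus_{n}V([n])$ is an equivalence from $\mathrm{FI}$-modules to graded left $A$-modules, and we identify the two notions. The $\mathrm{FI}$-homology $H^{\mathrm{FI}}_a$ is the $a$-th left derived functor of the right exact functor $V\mapsto V/JV$ (from $\mathrm{FI}$-modules to $\mathrm{FI}$-modules), i.e. $H^{\mathrm{FI}}_a(V)=\mathrm{Tor}^A_a(A/J,V)$. The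 complex $\widetilde{S}_{-*}V$: for a finite set $I$, $RI$ is the free $R$-module on $I$ and $\det(I)=\bigwedge^{|I|}RI$ (so $\det(\emptyset)=R$). For an $\mathrm{FI}$-module $V$, a finite set $X$, $T\subset X$, $i\in X\setminus T$ and $v\in V(T)$, write $i(v)=\iota(v)\in V(T\cup\{i\})$, where $\iota:T\to T\cup\{i\}$ is the inclusion. For $a\in\mathbb{N}$ put \[(\widetilde{S}_{-a}V)(X)=\bigoplus_{I\subset X,\ |I|=a}V(X\setminus I)\otimes_R\det(I).\] The differential $d:(\widetilde{S}_{-a}V)(X)\to(\widetilde{S}_{-a+1}V)(X)$ is given by $d(v\otimes i_1\wedge\cdots\wedge i_a)=\sum_{p=1}^a(-1)^p\, i_p(v)\otimes i_1\wedge\cdots\widehat{i_p}\cdots\wedge i_a$ for $v\in V(X\setminus I)$, $I=\{i_1,\dots,i_a\}$. For an injection $\alpha:X\to X'$, $\alpha(v\otimes i_1\wedge\cdots\wedge i_a)=\alpha(v)\otimes\alpha(i_1)\wedge\cdots\wedge\alpha(i_a)$ with $\alpha(v)\in V(X'\setminus\alpha(I))$ (the image of $v$ under the restriction of $\alpha$ to $X\setminus I\to X'\setminus\alpha(I)$). This makes each $\widetilde{S}_{-a}V$ an $\mathrm{FI}$-module and $\cdots\to\widetilde{S}_{-2}V\to\widetilde{S}_{-1}V\to\widetilde{S}_0V\to0$ a complex of $\mathrm{FI}$-modules, whose homology $H_a(\widetilde{S}_{-*}V)$ (taken at $\widetilde{S}_{-a}V$) is an $\mathrm{FI}$-module. 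*)

theory Defs
  imports Main "HOL-Library.FuncSet"
begin

record ('r, 'a) rmod =
  carr :: "'a set"
  madd :: "'a \<Rightarrow> 'a \<Rightarrow> 'a"
  mzero :: "'a"
  msmul :: "'r \<Rightarrow> 'a \<Rightarrow> 'a"

definition is_rmod :: "('r::comm_ring_1, 'a) rmod \<Rightarrow> bool" where
  "is_rmod M \<longleftrightarrow>
     mzero M \<in> carr M \<and>
     (\<forall>x\<in>carr M. \<forall>y\<in>carr M. madd M x y \<in> carr M) \<and>
     (\<forall>r. \<forall>x\<in>carr M. msmul M r x \<in> carr M) \<and>
     (\<forall>x\<in>carr M. \<forall>y\<in>carr M. \<forall>z\<in>carr M. madd M (madd M x y) z = madd M x (madd M y z)) \<and>
     (\<forall>x\<in>carr M. \<forall>y\<in>carr M. madd M x y = madd M y x) \<and>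
     (\<forall>x\<in>carr M. madd M (mzero M) x = x) \<and>
     (\<forall>x\<in>carr M. \<exists>y\<in>carr M. madd M x y = mzero M) \<and>
     (\<forall>r s. \<forall>x\<in>carr M. msmul M (r * s) x = msmul M r (msmul M s x)) \<and>
     (\<forall>r s. \<forall>x\<in>carr M. msmul M (r + s) x = madd M (msmul M r x) (msmul M s x)) \<and>
     (\<forall>r. \<forall>x\<in>carr M. \<forall>y\<in>carr M. msmul M r (madd M x y) = madd M (msmul M r x) (msmul M r y)) \<and>
     (\<forall>x\<in>carr M. msmul M 1 x = x)"

definition rlinear :: "('r::comm_ring_1, 'a) rmod \<Rightarrow> ('r, 'b) rmod \<Rightarrow> ('a \<Rightarrow> 'b) \<Rightarrow> bool" where
  "rlinear M N f \<longleftrightarrow>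
     (\<forall>x\<in>carr M. f x \<in> carr N) \<and>
     (\<forall>x\<in>carr M. \<forall>y\<in>carr M. f (madd M x y) = madd N (f x) (f y)) \<and>
     (\<forall>r. \<forall>x\<in>carr M. f (msmul M r x) = msmul N r (f x))"

definition rsubmod :: "('r::comm_ring_1, 'a) rmod \<Rightarrow> 'a set \<Rightarrow> bool" where
  "rsubmod M S \<longleftrightarrow> S \<subseteq> carr M \<and> mzero M \<in> S \<and>
     (\<forall>x\<in>S. \<forall>y\<in>S. madd M x y \<in> S) \<and> (\<forall>r. \<forall>x\<in>S. msmul M r x \<in> S)"

definition rspan :: "('r::comm_ring_1, 'a) rmod \<Rightarrow> 'a set \<Rightarrow> 'a set" where
  "rspan M G = \<Inter>{S. rsubmod M S \<and> G \<subseteq> S}"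

definition msum :: "('r, 'a) rmod \<Rightarrow> ('i \<Rightarrow> 'a) \<Rightarrow> 'i set \<Rightarrow> 'a" where
  "msum M f A = Finite_Set.fold (\<lambda>i acc. madd M (f i) acc) (mzero M) A"

definition rcoset :: "('r, 'a) rmod \<Rightarrow> 'a set \<Rightarrow> 'a \<Rightarrow> 'a set" where
  "rcoset M S x = {y \<in> carr M. \<exists>s\<in>S. y = madd M x s}"

definition rquot :: "('r, 'a) rmod \<Rightarrow> 'a set \<Rightarrow> ('r, 'a set) rmod" where
  "rquot M S = \<lparr> carr = rcoset M S ` carr M,
     madd = (\<lambda>A B. {y \<in> carr M. \<exists>a\<in>A. \<exists>b\<in>B. \<exists>s\<in>S. y = madd M (madd M a b) s}),
     mzero = rcoset M S (mzero M),
     msmul = (\<lambda>r A. {y \<in> carr M. \<exists>a\<in>A. \<exists>s\<in>S. y = madd M (msmul M r a) s}) \<rparr>"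

definition qmap :: "('r, 'b) rmod \<Rightarrow> 'b set \<Rightarrow> ('a \<Rightarrow> 'b) \<Rightarrow> 'a set \<Rightarrow> 'b set" where
  "qmap N T f A = {y \<in> carr N. \<exists>a\<in>A. \<exists>t\<in>T. y = madd N (f a) t}"

text \<open>We use the (equivalent) category whose objects are the finite subsets of nat
  (it contains the skeleton [n] = {1..n}) and whose morphisms X \<rightarrow> Y are injections;
  a morphism is given by any function agreeing with it on X.\<close>

definition fi_inj :: "nat set \<Rightarrow> nat set \<Rightarrow> (nat \<Rightarrow> nat) \<Rightarrow> bool" where
  "fi_inj X Y \<alpha> \<longleftrightarrow> finite X \<and> finite Y \<and> inj_on \<alpha> X \<and> \<alpha> ` X \<subseteq> Y"

definition fi_homs :: "nat set \<Rightarrow> nat set \<Rightarrow> (nat \<Rightarrow> nat) set" where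
  "fi_homs X Y = {\<alpha> \<in> extensional X. inj_on \<alpha> X \<and> \<alpha> ` X \<subseteq> Y}"

record ('r, 'v) fimod =
  fobj :: "nat set \<Rightarrow> ('r, 'v) rmod"
  fmor :: "nat set \<Rightarrow> nat set \<Rightarrow> (nat \<Rightarrow> nat) \<Rightarrow> 'v \<Rightarrow> 'v"

definition is_fimod :: "('r::comm_ring_1, 'v) fimod \<Rightarrow> bool" where
  "is_fimod V \<longleftrightarrow>
     (\<forall>X. finite X \<longrightarrow> is_rmod (fobj V X)) \<and>
     (\<forall>X Y \<alpha>. fi_inj X Y \<alpha> \<longrightarrow> rlinear (fobj V X) (fobj V Y) (fmor V X Y \<alpha>)) \<and>
     (\<forall>X Y \<alpha> \<beta>. fi_inj X Y \<alpha> \<and> (\<forall>x\<in>X. \<alpha> x = \<beta> x) \<longrightarrow>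
        (\<forall>v\<in>carr (fobj V X). fmor V X Y \<alpha> v = fmor V X Y \<beta> v)) \<and>
     (\<forall>X. finite X \<longrightarrow> (\<forall>v\<in>carr (fobj V X). fmor V X X id v = v)) \<and>
     (\<forall>X Y Z \<alpha> \<beta>. fi_inj X Y \<alpha> \<and> fi_inj Y Z \<beta> \<longrightarrow>
        (\<forall>v\<in>carr (fobj V X). fmor V X Z (\<beta> \<circ> \<alpha>) v = fmor V Y Z \<beta> (fmor V X Y \<alpha> v)))"

definition fi_hom :: "('r::comm_ring_1, 'v) fimod \<Rightarrow> ('r, 'w) fimod \<Rightarrow> (nat set \<Rightarrow> 'v \<Rightarrow> 'w) \<Rightarrow> bool" where
  "fi_hom V W \<phi> \<longleftrightarrow>
     (\<forall>X. finite X \<longrightarrow> rlinear (fobj V X) (fobj W X) (\<phi> X)) \<and>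
     (\<forall>X Y \<alpha>. fi_inj X Y \<alpha> \<longrightarrow>
        (\<forall>v\<in>carr (fobj V X). \<phi> Y (fmor V X Y \<alpha> v) = fmor W X Y \<alpha> (\<phi> X v)))"

definition fi_iso :: "('r::comm_ring_1, 'v) fimod \<Rightarrow> ('r, 'w) fimod \<Rightarrow> (nat set \<Rightarrow> 'v \<Rightarrow> 'w) \<Rightarrow> bool" where
  "fi_iso V W \<phi> \<longleftrightarrow> fi_hom V W \<phi> \<and>
     (\<forall>X. finite X \<longrightarrow> bij_betw (\<phi> X) (carr (fobj V X)) (carr (fobj W X)))"

definition fi_isomorphic :: "('r::comm_ring_1, 'v) fimod \<Rightarrow> ('r, 'w) fimod \<Rightarrow> bool" where
  "fi_isomorphic V W \<longleftrightarrow> (\<exists>\<phi>. fi_iso V W \<phi>)"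

definition fi_sub :: "('r, 'v) fimod \<Rightarrow> (nat set \<Rightarrow> 'v set) \<Rightarrow> ('r, 'v) fimod" where
  "fi_sub V S = \<lparr> fobj = (\<lambda>X. (fobj V X)\<lparr>carr := S X\<rparr>), fmor = fmor V \<rparr>"

definition fi_quot :: "('r, 'v) fimod \<Rightarrow> (nat set \<Rightarrow> 'v set) \<Rightarrow> ('r, 'v set) fimod" where
  "fi_quot V S = \<lparr> fobj = (\<lambda>X. rquot (fobj V X) (S X)),
                   fmor = (\<lambda>X Y \<alpha>. qmap (fobj V Y) (S Y) (fmor V X Y \<alpha>)) \<rparr>"

text \<open>A complex is C :: nat \<Rightarrow> FI-module with differentials d n : C (n+1) \<rightarrow> C n.
  Its homology at a is ker(d (a-1)) / im(d a) (with ker = C 0 at a = 0).\<close>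

definition cx_cycles :: "(nat \<Rightarrow> ('r, 'c) fimod) \<Rightarrow> (nat \<Rightarrow> nat set \<Rightarrow> 'c \<Rightarrow> 'c) \<Rightarrow> nat \<Rightarrow> nat set \<Rightarrow> 'c set" where
  "cx_cycles C d a X = (if a = 0 then carr (fobj (C 0) X)
     else {x \<in> carr (fobj (C a) X). d (a - 1) X x = mzero (fobj (C (a - 1)) X)})"

definition cx_bounds :: "(nat \<Rightarrow> ('r, 'c) fimod) \<Rightarrow> (nat \<Rightarrow> nat set \<Rightarrow> 'c \<Rightarrow> 'c) \<Rightarrow> nat \<Rightarrow> nat set \<Rightarrow> 'c set" where
  "cx_bounds C d a X = d a X ` carr (fobj (C (Suc a)) X)"

definition fi_homology :: "(nat \<Rightarrow> ('r, 'c) fimod) \<Rightarrow> (nat \<Rightarrow> nat set \<Rightarrow> 'c \<Rightarrow> 'c) \<Rightarrow> nat \<Rightarrow> ('r, 'c set) fimod" where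
  "fi_homology C d a = fi_quot (fi_sub (C a) (cx_cycles C d a)) (cx_bounds C d a)"

text \<open>(JV)(X): the submodule generated by the images of all V(Y) \<rightarrow> V(X) along
  injections Y \<rightarrow> X with |Y| < |X| (i.e. the action of J = \<Oplus>_{m<n} A_{m,n}).\<close>
definition Jsub :: "('r::comm_ring_1, 'v) fimod \<Rightarrow> nat set \<Rightarrow> 'v set" where
  "Jsub V X = rspan (fobj V X)
     (\<Union>{fmor V Y X \<alpha> ` carr (fobj V Y) | Y \<alpha>. fi_inj Y X \<alpha> \<and> card Y < card X})"

definition fi_coinv :: "('r::comm_ring_1, 'v) fimod \<Rightarrow> ('r, 'v set) fimod" where
  "fi_coinv V = fi_quot V (Jsub V)"

definition fi_coinv_map :: "('r::comm_ring_1, 'w) fimod \<Rightarrow> (nat set \<Rightarrow> 'v \<Rightarrow> 'w) \<Rightarrow> nat set \<Rightarrow> 'v set \<Rightarrow> 'w set" where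
  "fi_coinv_map W f X = qmap (fobj W X) (Jsub W X) (f X)"

text \<open>Free FI-modules: direct sums of representables M(deg b) = R[Hom_FI(deg b, -)],
  i.e. there is a family of basis elements b \<in> P(deg b) such that for every Y the
  elements \<alpha>(b), \<alpha> \<in> Hom_FI(deg b, Y), form an R-basis of P(Y).\<close>
definition is_free_fimod :: "('r::comm_ring_1, 'p) fimod \<Rightarrow> bool" where
  "is_free_fimod P \<longleftrightarrow> (\<exists>B deg.
     (\<forall>b\<in>B. finite (deg b) \<and> b \<in> carr (fobj P (deg b))) \<and>
     (\<forall>Y. finite Y \<longrightarrow> (\<forall>y\<in>carr (fobj P Y). \<exists>!c :: 'p \<times> (nat \<Rightarrow> nat) \<Rightarrow> 'r.
        {k. c k \<noteq> 0} \<subseteq> Sigma B (\<lambda>b. fi_homs (deg b) Y) \<and> finite {k. c k \<noteq> 0} \<and>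
        y = msum (fobj P Y) (\<lambda>(b, \<alpha>). msmul (fobj P Y) (c (b, \<alpha>)) (fmor P (deg b) Y \<alpha> b))
              {k. c k \<noteq> 0})))"

definition fi_free_resolution :: "('r::comm_ring_1, 'v) fimod \<Rightarrow> (nat \<Rightarrow> ('r, 'p) fimod) \<Rightarrow>
    (nat \<Rightarrow> nat set \<Rightarrow> 'p \<Rightarrow> 'p) \<Rightarrow> (nat set \<Rightarrow> 'p \<Rightarrow> 'v) \<Rightarrow> bool" where
  "fi_free_resolution V P dP eps \<longleftrightarrow>
     (\<forall>n. is_fimod (P n) \<and> is_free_fimod (P n) \<and> fi_hom (P (Suc n)) (P n) (dP n)) \<and>
     fi_hom (P 0) V eps \<and>
     (\<forall>X. finite X \<longrightarrow>
        eps X ` carr (fobj (P 0) X) = carr (fobj V X) \<and>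
        {x \<in> carr (fobj (P 0) X). eps X x = mzero (fobj V X)} = dP 0 X ` carr (fobj (P 1) X) \<and>
        (\<forall>n. {x \<in> carr (fobj (P (Suc n)) X). dP n X x = mzero (fobj (P n) X)}
              = dP (Suc n) X ` carr (fobj (P (Suc (Suc n))) X)))"

definition FI_homology :: "(nat \<Rightarrow> ('r::comm_ring_1, 'p) fimod) \<Rightarrow> (nat \<Rightarrow> nat set \<Rightarrow> 'p \<Rightarrow> 'p) \<Rightarrow> nat \<Rightarrow> ('r, 'p set set) fimod" where
  "FI_homology P dP a = fi_homology (\<lambda>n. fi_coinv (P n)) (\<lambda>n. fi_coinv_map (P n) (dP n)) a"

text \<open>(S~_{-a} V)(X) = \<Oplus>_{I \<subseteq> X, |I| = a} V(X - I) \<otimes> det(I). Since det(I) is free of rank one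
  with basis i_1 \<and> \<dots> \<and> i_a (i_1 < \<dots> < i_a), an element is represented as a function
  c with c I \<in> V(X - I) (the coefficient of \<dots> \<otimes> i_1 \<and> \<dots> \<and> i_a), undefined off the index set.\<close>

definition Stilde_obj :: "('r::comm_ring_1, 'v) fimod \<Rightarrow> nat \<Rightarrow> nat set \<Rightarrow> ('r, nat set \<Rightarrow> 'v) rmod" where
  "Stilde_obj V a X = \<lparr>
     carr = {c. (\<forall>I. I \<subseteq> X \<and> card I = a \<longrightarrow> c I \<in> carr (fobj V (X - I))) \<and>
                (\<forall>I. \<not> (I \<subseteq> X \<and> card I = a) \<longrightarrow> c I = undefined)},
     madd = (\<lambda>c c' I. if I \<subseteq> X \<and> card I = a then madd (fobj V (X - I)) (c I) (c' I) else undefined),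
     mzero = (\<lambda>I. if I \<subseteq> X \<and> card I = a then mzero (fobj V (X - I)) else undefined),
     msmul = (\<lambda>r c I. if I \<subseteq> X \<and> card I = a then msmul (fobj V (X - I)) r (c I) else undefined) \<rparr>"

text \<open>Sign of \<alpha>(i_1) \<and> \<dots> \<and> \<alpha>(i_a) relative to the increasingly ordered wedge of \<alpha>(I).\<close>
definition wsign :: "(nat \<Rightarrow> nat) \<Rightarrow> nat set \<Rightarrow> 'r::comm_ring_1" where
  "wsign \<alpha> I = (-1) ^ card {(i, j). i \<in> I \<and> j \<in> I \<and> i < j \<and> \<alpha> j < \<alpha> i}"

definition Stilde_mor :: "('r::comm_ring_1, 'v) fimod \<Rightarrow> nat \<Rightarrow> nat set \<Rightarrow> nat set \<Rightarrow> (nat \<Rightarrow> nat) \<Rightarrow>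
    (nat set \<Rightarrow> 'v) \<Rightarrow> (nat set \<Rightarrow> 'v)" where
  "Stilde_mor V a X Y \<alpha> c = (\<lambda>J.
     if J \<subseteq> Y \<and> card J = a then
       (if J \<subseteq> \<alpha> ` X then
          (let I = inv_into X \<alpha> ` J in
             msmul (fobj V (Y - J)) (wsign \<alpha> I) (fmor V (X - I) (Y - J) \<alpha> (c I)))
        else mzero (fobj V (Y - J)))
     else undefined)"

definition Stilde :: "('r::comm_ring_1, 'v) fimod \<Rightarrow> nat \<Rightarrow> ('r, nat set \<Rightarrow> 'v) fimod" where
  "Stilde V a = \<lparr> fobj = Stilde_obj V a, fmor = Stilde_mor V a \<rparr>"

text \<open>Differential d : S~_{-(a+1)} V \<rightarrow> S~_{-a} V,
  d(v \<otimes> i_1 \<and> \<dots> \<and> i_{a+1}) = \<Sum>_p (-1)^p i_p(v) \<otimes> i_1 \<and> \<dots> \<widehat>{i_p} \<dots> \<and> i_{a+1};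
  the position p of i in insert i I' is card {j \<in> insert i I'. j \<le> i}.\<close>
definition dStilde :: "('r::comm_ring_1, 'v) fimod \<Rightarrow> nat \<Rightarrow> nat set \<Rightarrow> (nat set \<Rightarrow> 'v) \<Rightarrow> (nat set \<Rightarrow> 'v)" where
  "dStilde V a X c = (\<lambda>I'.
     if I' \<subseteq> X \<and> card I' = a then
       msum (fobj V (X - I'))
         (\<lambda>i. msmul (fobj V (X - I')) ((-1) ^ card {j \<in> insert i I'. j \<le> i})
                (fmor V (X - insert i I') (X - I') id (c (insert i I'))))
         (X - I')
     else undefined)"

end

(* Applying the exact functors V |-> S_{-i} V to the free resolution P gives a double complex
   S_{-i} P_j. Its rows are exact because they are so pointwise, with augmentation S_{-i} V. Its
   columns are exact because, for a fixed basis element of a free FI-module, the complex is the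
   augmented chain complex of a simplex; their augmentation is P_j / J P_j, as J P is the image of
   the differential in degree zero. So the homology of both augmentations agrees. The isomorphism
   is obtained by composing the linear relations d x = e y along a diagonal of the double complex. *)

theory Submission
  imports Defs
begin

subsection \<open>Modules over a commutative ring\<close>

text \<open>No total complex is formed: the relation d x = e y makes sense in a double complex with
  commuting squares, so no alternating signs have to be introduced. It induces isomorphisms of the
  subquotients \<open>Z i j\<close> modulo \<open>B i j\<close> along an antidiagonal, and at the
  two ends these are the preimages of cycles and boundaries under the augmentations. The columns
  split because the key (b, \<alpha>) of a basis element does not mention the target: following
  \<alpha> with an inclusion gives \<alpha> again. Every map in \<open>dStilde\<close> therefore
  preserves coordinates, and for each key there remains a complex of scalars on the subsets of the
  complement of the image of \<alpha>. This complement is empty exactly when \<alpha> is onto; such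
  keys survive in degree zero and give P/JP, all others give a contractible complex. The identity d
  d = 0 is also checked in coordinates, hence only for free modules. It passes to an arbitrary V
  along the surjections from the complex of P_0 to that of V.\<close>

lemma
  assumes "is_rmod M"
  shows rmod_zero_closed: "mzero M \<in> carr M"
    and rmod_add_closed: "\<And>x y. x \<in> carr M \<Longrightarrow> y \<in> carr M \<Longrightarrow> madd M x y \<in> carr M"
    and rmod_smul_closed: "\<And>r x. x \<in> carr M \<Longrightarrow> msmul M r x \<in> carr M"
    and rmod_assoc: "\<And>x y z. x \<in> carr M \<Longrightarrow> y \<in> carr M \<Longrightarrow> z \<in> carr M \<Longrightarrow>
      madd M (madd M x y) z = madd M x (madd M y z)"
    and rmod_comm: "\<And>x y. x \<in> carr M \<Longrightarrow> y \<in> carr M \<Longrightarrow> madd M x y = madd M y x"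
    and rmod_zero_add: "\<And>x. x \<in> carr M \<Longrightarrow> madd M (mzero M) x = x"
    and rmod_smul_smul: "\<And>r s x. x \<in> carr M \<Longrightarrow> msmul M r (msmul M s x) = msmul M (r * s) x"
    and rmod_add_smul: "\<And>r s x. x \<in> carr M \<Longrightarrow>
      msmul M (r + s) x = madd M (msmul M r x) (msmul M s x)"
    and rmod_smul_add: "\<And>r x y. x \<in> carr M \<Longrightarrow> y \<in> carr M \<Longrightarrow>
      msmul M r (madd M x y) = madd M (msmul M r x) (msmul M r y)"
    and rmod_one_smul: "\<And>x. x \<in> carr M \<Longrightarrow> msmul M 1 x = x"
proof -
  note 1 = assms[unfolded is_rmod_def]
  note 2 = 1[THEN conjunct2]
  note 3 = 2[THEN conjunct2]
  note 4 = 3[THEN conjunct2]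
  note 5 = 4[THEN conjunct2]
  note 6 = 5[THEN conjunct2]
  note 7 = 6[THEN conjunct2, THEN conjunct2]
  note 8 = 7[THEN conjunct2]
  note 9 = 8[THEN conjunct2]
  show "mzero M \<in> carr M"
    using 1 by (rule conjunct1)
  show "\<And>x y. x \<in> carr M \<Longrightarrow> y \<in> carr M \<Longrightarrow> madd M x y \<in> carr M"
    "\<And>r x. x \<in> carr M \<Longrightarrow> msmul M r x \<in> carr M"
    "\<And>x y z. x \<in> carr M \<Longrightarrow> y \<in> carr M \<Longrightarrow> z \<in> carr M \<Longrightarrow>
      madd M (madd M x y) z = madd M x (madd M y z)"
    "\<And>x y. x \<in> carr M \<Longrightarrow> y \<in> carr M \<Longrightarrow> madd M x y = madd M y x"
    "\<And>x. x \<in> carr M \<Longrightarrow> madd M (mzero M) x = x"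
    "\<And>r s x. x \<in> carr M \<Longrightarrow> msmul M r (msmul M s x) = msmul M (r * s) x"
    "\<And>r s x. x \<in> carr M \<Longrightarrow> msmul M (r + s) x = madd M (msmul M r x) (msmul M s x)"
    "\<And>r x y. x \<in> carr M \<Longrightarrow> y \<in> carr M \<Longrightarrow>
      msmul M r (madd M x y) = madd M (msmul M r x) (msmul M r y)"
    "\<And>x. x \<in> carr M \<Longrightarrow> msmul M 1 x = x"
    using 2[THEN conjunct1] 3[THEN conjunct1] 4[THEN conjunct1] 5[THEN conjunct1]
      6[THEN conjunct1] 7[THEN conjunct1] 8[THEN conjunct1] 9[THEN conjunct1] 9[THEN conjunct2]
    by (blast, blast, blast, blast, blast, simp, blast, blast, blast)
qed

lemmas rmod_closed = rmod_zero_closed rmod_add_closed rmod_smul_closed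

lemma rmod_add_zero: "is_rmod M \<Longrightarrow> x \<in> carr M \<Longrightarrow> madd M x (mzero M) = x"
  by (metis rmod_comm rmod_zero_add rmod_zero_closed)

lemma rmod_lcomm: "is_rmod M \<Longrightarrow> x \<in> carr M \<Longrightarrow> y \<in> carr M \<Longrightarrow> z \<in> carr M \<Longrightarrow>
    madd M x (madd M y z) = madd M y (madd M x z)"
  by (metis rmod_assoc rmod_comm)

lemma rmod_ex_inverse: "is_rmod M \<Longrightarrow> x \<in> carr M \<Longrightarrow> \<exists>y\<in>carr M. madd M x y = mzero M"
  unfolding is_rmod_def by (elim conjE) blast

lemma rmod_cancel:
  assumes "is_rmod M" "x \<in> carr M" "y \<in> carr M" "z \<in> carr M" "madd M x y = madd M x z"
  shows "y = z"
proof -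
  obtain w where w: "w \<in> carr M" "madd M x w = mzero M"
    using rmod_ex_inverse assms by metis
  have "madd M w (madd M x y) = madd M w (madd M x z)"
    using assms by simp
  then show ?thesis
    using assms w by (metis rmod_assoc rmod_comm rmod_zero_add)
qed

lemma rmod_zero_smul:
  assumes "is_rmod M" "x \<in> carr M"
  shows "msmul M 0 x = mzero M"
proof -
  have "madd M (msmul M 0 x) (msmul M 0 x) = madd M (msmul M 0 x) (mzero M)"
    using assms rmod_add_smul[OF assms, of 0 0]
    by (simp add: rmod_add_zero rmod_closed)
  then show ?thesis
    using assms rmod_cancel by (metis rmod_closed)
qed

lemma rmod_smul_zero:
  assumes "is_rmod M"
  shows "msmul M r (mzero M) = mzero M"
  using assms by (metis mult_zero_right rmod_smul_smul rmod_zero_smul rmod_zero_closed)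

text \<open>The record has no negation. With scaling by -1 in its place, anything closed under sums
  and scalars, be it a submodule, a linear map or a relation, is compatible with differences at
  once.\<close>

abbreviation msub :: "('r::comm_ring_1, 'a) rmod \<Rightarrow> 'a \<Rightarrow> 'a \<Rightarrow> 'a" where
  "msub M x y \<equiv> madd M x (msmul M (- 1) y)"

lemma rmod_sub_self: "is_rmod M \<Longrightarrow> x \<in> carr M \<Longrightarrow> msub M x x = mzero M"
  using rmod_add_smul[of M x 1 "- 1"] by (simp add: rmod_one_smul rmod_zero_smul)

lemma rmod_sub_add:
  assumes "is_rmod M" "x \<in> carr M" "y \<in> carr M"
  shows "madd M y (msub M x y) = x"
  using assms by (simp add: rmod_lcomm rmod_closed rmod_sub_self rmod_add_zero)

lemma rmod_add_sub:
  assumes "is_rmod M" "x \<in> carr M" "y \<in> carr M"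
  shows "msub M (madd M x y) x = y"
  using assms rmod_cancel[of M x "msub M (madd M x y) x" y] by (simp add: rmod_sub_add rmod_closed)

lemma rmod_sub_eq_zero:
  assumes "is_rmod M" "x \<in> carr M" "y \<in> carr M"
  shows "msub M x y = mzero M \<longleftrightarrow> x = y"
  using assms rmod_sub_add rmod_sub_self rmod_add_zero by metis

lemma
  assumes "rlinear M N f"
  shows rlinear_closed: "\<And>x. x \<in> carr M \<Longrightarrow> f x \<in> carr N"
    and rlinear_add: "\<And>x y. x \<in> carr M \<Longrightarrow> y \<in> carr M \<Longrightarrow> f (madd M x y) = madd N (f x) (f y)"
    and rlinear_smul: "\<And>r x. x \<in> carr M \<Longrightarrow> f (msmul M r x) = msmul N r (f x)"
  using assms unfolding rlinear_def by auto

lemma rlinear_zero: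
  assumes "is_rmod M" "is_rmod N" "rlinear M N f"
  shows "f (mzero M) = mzero N"
  using assms rlinear_smul[OF assms(3) rmod_zero_closed[OF assms(1)], of 0]
  by (simp add: rmod_zero_smul rlinear_closed rmod_zero_closed)

lemma rlinear_sub:
  assumes "is_rmod M" "rlinear M N f" "x \<in> carr M" "y \<in> carr M"
  shows "f (msub M x y) = msub N (f x) (f y)"
  using assms by (simp add: rlinear_add rlinear_smul rmod_closed)

lemma rlinear_eq_iff:
  assumes "is_rmod M" "is_rmod N" "rlinear M N f" "x \<in> carr M" "y \<in> carr M"
  shows "f x = f y \<longleftrightarrow> f (msub M x y) = mzero N"
  using assms by (simp add: rlinear_sub rmod_sub_eq_zero rlinear_closed)

lemma
  assumes "rsubmod M S"
  shows rsubmod_subset: "\<And>x. x \<in> S \<Longrightarrow> x \<in> carr M"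
    and rsubmod_zero: "mzero M \<in> S"
    and rsubmod_add: "\<And>x y. x \<in> S \<Longrightarrow> y \<in> S \<Longrightarrow> madd M x y \<in> S"
    and rsubmod_smul: "\<And>r x. x \<in> S \<Longrightarrow> msmul M r x \<in> S"
  using assms unfolding rsubmod_def by auto

text \<open>\<open>rsubmod\<close> does not ask for inverses; they come from scaling by -1.\<close>

lemma is_rmod_restrict:
  assumes "is_rmod M" "rsubmod M S"
  shows "is_rmod (M\<lparr>carr := S\<rparr>)"
proof -
  have "\<exists>y\<in>S. madd M x y = mzero M" if "x \<in> S" for x
    using assms that by (intro bexI[of _ "msmul M (- 1) x"])
      (simp_all add: rmod_sub_self rsubmod_subset rsubmod_smul)
  then show ?thesis
    using assms rsubmod_subset[OF assms(2)] unfolding is_rmod_def[of "M\<lparr>carr := S\<rparr>"]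
    by (simp add: rsubmod_zero rsubmod_add rsubmod_smul rmod_assoc rmod_comm rmod_lcomm
        rmod_add_zero rmod_smul_smul rmod_add_smul rmod_smul_add rmod_one_smul)
qed

lemma rsubmod_image:
  assumes "is_rmod M" "is_rmod N" "rlinear M N f"
  shows "rsubmod N (f ` carr M)"
  unfolding rsubmod_def
proof (intro conjI ballI allI)
  show "f ` carr M \<subseteq> carr N"
    using assms by (auto dest: rlinear_closed)
  show "mzero N \<in> f ` carr M"
    using assms rlinear_zero rmod_zero_closed by (metis image_eqI)
  show "madd N x y \<in> f ` carr M" if "x \<in> f ` carr M" "y \<in> f ` carr M" for x y
    using that assms by (force simp: rlinear_add[symmetric] intro!: imageI rmod_closed)
  show "msmul N r x \<in> f ` carr M" if "x \<in> f ` carr M" for r x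
    using that assms by (force simp: rlinear_smul[symmetric] intro!: imageI rmod_closed)
qed

lemma rsubmod_kernel:
  assumes "is_rmod M" "is_rmod N" "rlinear M N f"
  shows "rsubmod M {x \<in> carr M. f x = mzero N}"
  unfolding rsubmod_def using assms
  by (auto simp: rmod_closed rlinear_add rlinear_smul rlinear_zero rmod_add_zero rmod_smul_zero)

lemma rsubmod_carr: "is_rmod M \<Longrightarrow> rsubmod M (carr M)"
  by (simp add: rsubmod_def rmod_closed)

subsection \<open>Quotient modules\<close>

lemma mem_rcoset_iff:
  assumes "is_rmod M" "rsubmod M S" "x \<in> carr M"
  shows "y \<in> rcoset M S x \<longleftrightarrow> y \<in> carr M \<and> msub M y x \<in> S"
proof -
  have "\<exists>s\<in>S. y = madd M x s" if "y \<in> carr M" "msub M y x \<in> S"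
    using that assms by (intro bexI[of _ "msub M y x"]) (simp_all add: rmod_sub_add)
  then show ?thesis
    using assms by (auto simp: rcoset_def rmod_add_sub dest: rsubmod_subset)
qed

lemma rcoset_self: "is_rmod M \<Longrightarrow> rsubmod M S \<Longrightarrow> x \<in> carr M \<Longrightarrow> x \<in> rcoset M S x"
  by (simp add: mem_rcoset_iff rmod_sub_self rsubmod_zero)

lemma rcoset_eq_iff:
  assumes M: "is_rmod M" "rsubmod M S" and x: "x \<in> carr M" and y: "y \<in> carr M"
  shows "rcoset M S x = rcoset M S y \<longleftrightarrow> msub M x y \<in> S"
proof
  assume "rcoset M S x = rcoset M S y"
  then show "msub M x y \<in> S"
    using rcoset_self[OF M x] mem_rcoset_iff[OF M y] by auto
next
  have *: "rcoset M S x \<subseteq> rcoset M S y"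
    if "msub M x y \<in> S" "x \<in> carr M" "y \<in> carr M" for x y
  proof
    fix z
    assume "z \<in> rcoset M S x"
    then have z: "z \<in> carr M" "msub M z x \<in> S"
      using mem_rcoset_iff[OF M] that by auto
    have "msub M z y = madd M (msub M z x) (msub M x y)"
      using rmod_sub_add[OF M(1) z(1) that(2)] M z(1) that(2,3)
      by (metis rmod_assoc rmod_comm rmod_smul_closed rmod_add_closed)
    then show "z \<in> rcoset M S y"
      using mem_rcoset_iff[OF M that(3)] z that(1) rsubmod_add[OF M(2)] by simp
  qed
  assume xy: "msub M x y \<in> S"
  have "msmul M (- 1) (msub M x y) = msub M y x"
    using M x y by (simp add: rmod_smul_add rmod_closed rmod_smul_smul rmod_one_smul rmod_comm)
  then have "msub M y x \<in> S"
    using rsubmod_smul[OF M(2) xy] by metis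
  then show "rcoset M S x = rcoset M S y"
    using *[OF xy x y] *[of y x] x y by blast
qed

lemma rcoset_eq_zero_iff:
  assumes "is_rmod M" "rsubmod M S" "x \<in> carr M"
  shows "rcoset M S x = rcoset M S (mzero M) \<longleftrightarrow> x \<in> S"
  using assms by (simp add: rcoset_eq_iff rmod_closed rmod_smul_zero rmod_add_zero)

lemma mem_rcoset_eq:
  assumes "is_rmod M" "rsubmod M S" "x \<in> carr M" "y \<in> rcoset M S x"
  shows "y \<in> carr M" "rcoset M S y = rcoset M S x"
  using assms mem_rcoset_iff[OF assms(1-3)] rcoset_eq_iff[OF assms(1,2)] by auto

text \<open>\<open>qmap\<close> adds all of T to the image of the coset. This yields a full coset of
  T, in which the spread over S disappears because f maps S into T.\<close>

lemma qmap_rcoset: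
  assumes M: "is_rmod M" "rsubmod M S" and N: "is_rmod N" "rsubmod N T"
    and f: "rlinear M N f" "f ` S \<subseteq> T" and x: "x \<in> carr M"
  shows "qmap N T f (rcoset M S x) = rcoset N T (f x)"
proof (intro equalityI subsetI)
  fix y
  assume "y \<in> qmap N T f (rcoset M S x)"
  then obtain s t where st: "s \<in> S" "t \<in> T" and y: "y = madd N (f (madd M x s)) t" "y \<in> carr N"
    by (auto simp: qmap_def rcoset_def)
  then have "y = madd N (f x) (madd N (f s) t)"
    using M N f x rsubmod_subset[OF M(2) st(1)] rsubmod_subset[OF N(2) st(2)]
    by (simp add: rlinear_add rlinear_closed[OF f(1)] rmod_assoc)
  moreover have "madd N (f s) t \<in> T"
    using st f(2) rsubmod_add[OF N(2)] by blast
  ultimately show "y \<in> rcoset N T (f x)"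
    using y(2) by (auto simp: rcoset_def)
next
  fix y
  assume "y \<in> rcoset N T (f x)"
  then show "y \<in> qmap N T f (rcoset M S x)"
    using rcoset_self[OF M x] by (auto simp: qmap_def rcoset_def)
qed

lemma rquot_madd_rcoset:
  assumes M: "is_rmod M" "rsubmod M S" and x: "x \<in> carr M" and y: "y \<in> carr M"
  shows "madd (rquot M S) (rcoset M S x) (rcoset M S y) = rcoset M S (madd M x y)"
proof (intro equalityI subsetI)
  fix z
  assume "z \<in> madd (rquot M S) (rcoset M S x) (rcoset M S y)"
  then obtain s t u where st: "s \<in> S" "t \<in> S" "u \<in> S" and z: "z \<in> carr M"
    and eq: "z = madd M (madd M (madd M x s) (madd M y t)) u"
    by (auto simp: rquot_def rcoset_def)
  have c: "s \<in> carr M" "t \<in> carr M" "u \<in> carr M"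
    using st rsubmod_subset[OF M(2)] by auto
  have "z = madd M (madd M x y) (madd M s (madd M t u))"
    unfolding eq using M(1) x y c by (simp add: rmod_assoc rmod_closed rmod_lcomm)
  then show "z \<in> rcoset M S (madd M x y)"
    using z st rsubmod_add[OF M(2)] by (auto simp: rcoset_def)
next
  fix z
  assume "z \<in> rcoset M S (madd M x y)"
  then show "z \<in> madd (rquot M S) (rcoset M S x) (rcoset M S y)"
    using rcoset_self[OF M x] rcoset_self[OF M y] by (auto simp: rquot_def rcoset_def)
qed

lemma rquot_msmul_rcoset:
  assumes M: "is_rmod M" "rsubmod M S" and x: "x \<in> carr M"
  shows "msmul (rquot M S) r (rcoset M S x) = rcoset M S (msmul M r x)"
proof (intro equalityI subsetI)
  fix z
  assume "z \<in> msmul (rquot M S) r (rcoset M S x)"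
  then obtain s u where st: "s \<in> S" "u \<in> S" and z: "z \<in> carr M"
    and eq: "z = madd M (msmul M r (madd M x s)) u"
    by (auto simp: rquot_def rcoset_def)
  have c: "s \<in> carr M" "u \<in> carr M"
    using st rsubmod_subset[OF M(2)] by auto
  have "z = madd M (msmul M r x) (madd M (msmul M r s) u)"
    unfolding eq using M(1) x c by (simp add: rmod_assoc rmod_closed rmod_smul_add)
  then show "z \<in> rcoset M S (msmul M r x)"
    using z st rsubmod_add[OF M(2)] rsubmod_smul[OF M(2)] by (auto simp: rcoset_def)
next
  fix z
  assume "z \<in> rcoset M S (msmul M r x)"
  then show "z \<in> msmul (rquot M S) r (rcoset M S x)"
    using rcoset_self[OF M x] by (auto simp: rquot_def rcoset_def)
qed

lemma rquot_carr: "carr (rquot M S) = rcoset M S ` carr M"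
  and rquot_mzero: "mzero (rquot M S) = rcoset M S (mzero M)"
  by (simp_all add: rquot_def)

lemmas rquot_simps = rquot_carr rquot_mzero rquot_madd_rcoset rquot_msmul_rcoset

lemma is_rmod_rquot:
  assumes "is_rmod M" "rsubmod M S"
  shows "is_rmod (rquot M S)"
proof -
  have "\<exists>y\<in>carr M. rcoset M S (madd M x y) = rcoset M S (mzero M)" if "x \<in> carr M" for x
    using rmod_ex_inverse[OF assms(1) that] by metis
  then show ?thesis
    using assms unfolding is_rmod_def[of "rquot M S"]
    by (simp add: rquot_simps rmod_closed rmod_assoc rmod_comm rmod_lcomm rmod_add_zero
        rmod_smul_smul rmod_add_smul rmod_smul_add rmod_one_smul)
qed

lemma rlinear_rcoset:
  assumes "is_rmod M" "rsubmod M S"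
  shows "rlinear M (rquot M S) (rcoset M S)"
  using assms by (simp add: rlinear_def rquot_simps)

lemma rlinear_qmap:
  assumes "is_rmod M" "rsubmod M S" "is_rmod N" "rsubmod N T" "rlinear M N f" "f ` S \<subseteq> T"
  shows "rlinear (rquot M S) (rquot N T) (qmap N T f)"
  using assms unfolding rlinear_def[of "rquot M S"]
  by (simp add: rquot_simps qmap_rcoset rmod_closed rlinear_closed rlinear_add rlinear_smul)

subsection \<open>Linear relations between subquotients\<close>

text \<open>The functor laws play no role in comparing the homology of complexes of FI-modules, so
  they are dropped here and never have to be verified for the terms of the double complex.\<close>
definition fi_premodule :: "('r::comm_ring_1, 'v) fimod \<Rightarrow> bool" where
  "fi_premodule V \<longleftrightarrow>
     (\<forall>X. finite X \<longrightarrow> is_rmod (fobj V X)) \<and>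
     (\<forall>X Y \<alpha>. fi_inj X Y \<alpha> \<longrightarrow> rlinear (fobj V X) (fobj V Y) (fmor V X Y \<alpha>))"

lemma fi_premodule_rmod: "fi_premodule V \<Longrightarrow> finite X \<Longrightarrow> is_rmod (fobj V X)"
  by (simp add: fi_premodule_def)

lemma fi_premodule_mor: "fi_premodule V \<Longrightarrow> fi_inj X Y \<alpha> \<Longrightarrow>
    rlinear (fobj V X) (fobj V Y) (fmor V X Y \<alpha>)"
  by (simp add: fi_premodule_def)

lemma is_fimod_premodule: "is_fimod V \<Longrightarrow> fi_premodule V"
  by (simp add: is_fimod_def fi_premodule_def)

lemma fi_hom_linear: "fi_hom V W \<phi> \<Longrightarrow> finite X \<Longrightarrow> rlinear (fobj V X) (fobj W X) (\<phi> X)"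
  by (simp add: fi_hom_def)

lemma fi_hom_natural: "fi_hom V W \<phi> \<Longrightarrow> fi_inj X Y \<alpha> \<Longrightarrow> v \<in> carr (fobj V X) \<Longrightarrow>
    \<phi> Y (fmor V X Y \<alpha> v) = fmor W X Y \<alpha> (\<phi> X v)"
  by (simp add: fi_hom_def)

lemma fi_inj_finite: "fi_inj X Y \<alpha> \<Longrightarrow> finite X \<and> finite Y"
  by (simp add: fi_inj_def)

definition fi_stable :: "('r::comm_ring_1, 'v) fimod \<Rightarrow> (nat set \<Rightarrow> 'v set) \<Rightarrow> bool" where
  "fi_stable V S \<longleftrightarrow> (\<forall>X. finite X \<longrightarrow> rsubmod (fobj V X) (S X)) \<and>
     (\<forall>X Y \<alpha>. fi_inj X Y \<alpha> \<longrightarrow> fmor V X Y \<alpha> ` S X \<subseteq> S Y)"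

lemma fi_stable_rsubmod: "fi_stable V S \<Longrightarrow> finite X \<Longrightarrow> rsubmod (fobj V X) (S X)"
  by (simp add: fi_stable_def)

lemma fi_stable_mor: "fi_stable V S \<Longrightarrow> fi_inj X Y \<alpha> \<Longrightarrow> fmor V X Y \<alpha> ` S X \<subseteq> S Y"
  by (simp add: fi_stable_def)

lemma fi_stable_image:
  assumes "fi_premodule V" "fi_premodule W" "fi_hom V W f"
  shows "fi_stable W (\<lambda>X. f X ` carr (fobj V X))"
  unfolding fi_stable_def
proof (intro conjI allI impI)
  show "rsubmod (fobj W X) (f X ` carr (fobj V X))" if "finite X" for X
    using assms that by (intro rsubmod_image fi_premodule_rmod fi_hom_linear)
  show "fmor W X Y \<alpha> ` f X ` carr (fobj V X) \<subseteq> f Y ` carr (fobj V Y)" if "fi_inj X Y \<alpha>" for X Y \<alpha>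
    using fi_hom_natural[OF assms(3) that] rlinear_closed[OF fi_premodule_mor[OF assms(1) that]]
    by (auto simp: image_iff) metis
qed

lemma fi_stable_kernel:
  assumes "fi_premodule V" "fi_premodule W" "fi_hom V W f"
  shows "fi_stable V (\<lambda>X. {x \<in> carr (fobj V X). f X x = mzero (fobj W X)})"
  unfolding fi_stable_def
proof (intro conjI allI impI)
  show "rsubmod (fobj V X) {x \<in> carr (fobj V X). f X x = mzero (fobj W X)}" if "finite X" for X
    using assms that by (intro rsubmod_kernel fi_premodule_rmod fi_hom_linear)
  show "fmor V X Y \<alpha> ` {x \<in> carr (fobj V X). f X x = mzero (fobj W X)}
      \<subseteq> {x \<in> carr (fobj V Y). f Y x = mzero (fobj W Y)}" if "fi_inj X Y \<alpha>" for X Y \<alpha>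
    using fi_hom_natural[OF assms(3) that] rlinear_closed[OF fi_premodule_mor[OF assms(1) that]]
      rlinear_zero[OF _ _ fi_premodule_mor[OF assms(2) that]] fi_inj_finite[OF that]
      fi_premodule_rmod[OF assms(2)]
    by auto
qed

text \<open>A correspondence that induces an isomorphism $Z/B \cong Z'/B'$ of subquotients of
  \<open>V\<close> and \<open>W\<close>. Working with relations instead of maps makes zigzags in a diagram compose
  without any choices.\<close>
definition fi_corr :: "('r::comm_ring_1, 'v) fimod \<Rightarrow> (nat set \<Rightarrow> 'v set) \<Rightarrow> (nat set \<Rightarrow> 'v set) \<Rightarrow>
    ('r, 'w) fimod \<Rightarrow> (nat set \<Rightarrow> 'w set) \<Rightarrow> (nat set \<Rightarrow> 'w set) \<Rightarrow>
    (nat set \<Rightarrow> 'v \<Rightarrow> 'w \<Rightarrow> bool) \<Rightarrow> bool" where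
  "fi_corr V Z B W Z' B' R \<longleftrightarrow>
     (\<forall>X. finite X \<longrightarrow>
        (\<forall>x y. R X x y \<longrightarrow> x \<in> Z X \<and> y \<in> Z' X \<and> (x \<in> B X \<longleftrightarrow> y \<in> B' X)) \<and>
        (\<forall>x\<in>Z X. \<exists>y. R X x y) \<and> (\<forall>y\<in>Z' X. \<exists>x. R X x y) \<and>
        (\<forall>x y x' y'. R X x y \<longrightarrow> R X x' y' \<longrightarrow>
           R X (madd (fobj V X) x x') (madd (fobj W X) y y')) \<and>
        (\<forall>r x y. R X x y \<longrightarrow> R X (msmul (fobj V X) r x) (msmul (fobj W X) r y))) \<and>
     (\<forall>X Y \<alpha> x y. fi_inj X Y \<alpha> \<longrightarrow> R X x y \<longrightarrow> R Y (fmor V X Y \<alpha> x) (fmor W X Y \<alpha> y))"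

lemma
  assumes "fi_corr V Z B W Z' B' R" "finite X"
  shows fi_corr_mem: "\<And>x y. R X x y \<Longrightarrow> x \<in> Z X \<and> y \<in> Z' X"
    and fi_corr_bounds: "\<And>x y. R X x y \<Longrightarrow> x \<in> B X \<longleftrightarrow> y \<in> B' X"
    and fi_corr_left: "\<And>x. x \<in> Z X \<Longrightarrow> \<exists>y. R X x y"
    and fi_corr_right: "\<And>y. y \<in> Z' X \<Longrightarrow> \<exists>x. R X x y"
    and fi_corr_add: "\<And>x y x' y'. R X x y \<Longrightarrow> R X x' y' \<Longrightarrow>
           R X (madd (fobj V X) x x') (madd (fobj W X) y y')"
    and fi_corr_smul: "\<And>r x y. R X x y \<Longrightarrow> R X (msmul (fobj V X) r x) (msmul (fobj W X) r y)"
proof -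
  note * = assms(1)[unfolded fi_corr_def, THEN conjunct1, rule_format (no_asm), OF assms(2)]
  note 1 = *[THEN conjunct1] and 2 = *[THEN conjunct2, THEN conjunct1]
    and 3 = *[THEN conjunct2, THEN conjunct2]
  note 4 = 3[THEN conjunct1] and 5 = 3[THEN conjunct2, THEN conjunct1]
    and 6 = 3[THEN conjunct2, THEN conjunct2]
  show "\<And>x y. R X x y \<Longrightarrow> x \<in> Z X \<and> y \<in> Z' X" "\<And>x y. R X x y \<Longrightarrow> x \<in> B X \<longleftrightarrow> y \<in> B' X"
    using 1 by blast+
  show "\<And>x. x \<in> Z X \<Longrightarrow> \<exists>y. R X x y"
    using 2 by blast
  show "\<And>y. y \<in> Z' X \<Longrightarrow> \<exists>x. R X x y"
    using 4 by blast
  show "\<And>x y x' y'. R X x y \<Longrightarrow> R X x' y' \<Longrightarrow>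
      R X (madd (fobj V X) x x') (madd (fobj W X) y y')"
    using 5 by simp
  show "\<And>r x y. R X x y \<Longrightarrow> R X (msmul (fobj V X) r x) (msmul (fobj W X) r y)"
    using 6 by simp
qed

lemma fi_corr_natural:
  assumes "fi_corr V Z B W Z' B' R" "fi_inj X Y \<alpha>" "R X x y"
  shows "R Y (fmor V X Y \<alpha> x) (fmor W X Y \<alpha> y)"
  using assms(1)[unfolded fi_corr_def, THEN conjunct2] assms(2,3) by simp

lemma fi_corrI:
  assumes "\<And>X x y. finite X \<Longrightarrow> R X x y \<Longrightarrow> x \<in> Z X \<and> y \<in> Z' X \<and> (x \<in> B X \<longleftrightarrow> y \<in> B' X)"
    and "\<And>X x. finite X \<Longrightarrow> x \<in> Z X \<Longrightarrow> \<exists>y. R X x y"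
    and "\<And>X y. finite X \<Longrightarrow> y \<in> Z' X \<Longrightarrow> \<exists>x. R X x y"
    and "\<And>X x y x' y'. finite X \<Longrightarrow> R X x y \<Longrightarrow> R X x' y' \<Longrightarrow>
           R X (madd (fobj V X) x x') (madd (fobj W X) y y')"
    and "\<And>X r x y. finite X \<Longrightarrow> R X x y \<Longrightarrow> R X (msmul (fobj V X) r x) (msmul (fobj W X) r y)"
    and "\<And>X Y \<alpha> x y. fi_inj X Y \<alpha> \<Longrightarrow> R X x y \<Longrightarrow> R Y (fmor V X Y \<alpha> x) (fmor W X Y \<alpha> y)"
  shows "fi_corr V Z B W Z' B' R"
  unfolding fi_corr_def by (intro conjI allI impI ballI; (rule assms | drule (1) assms(1)); simp)

lemma fi_corr_cong:
  assumes "fi_corr V Z B W Z' B' R" "\<And>X. finite X \<Longrightarrow> B1 X = B X" "\<And>X. finite X \<Longrightarrow> B2 X = B' X"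
  shows "fi_corr V Z B1 W Z' B2 R"
  using assms unfolding fi_corr_def by simp

lemma fi_corr_sym:
  assumes "fi_corr V Z B W Z' B' R"
  shows "fi_corr W Z' B' V Z B (\<lambda>X y x. R X x y)"
  by (rule fi_corrI) (use fi_corr_mem[OF assms] fi_corr_bounds[OF assms] fi_corr_left[OF assms]
    fi_corr_right[OF assms] fi_corr_add[OF assms] fi_corr_smul[OF assms] fi_corr_natural[OF assms]
    in \<open>simp; fail | blast\<close>)+

text \<open>Membership puts every intermediate y in \<open>Z'\<close>, on which both relations are
  total, so the composite is total on both sides.\<close>

lemma fi_corr_trans:
  assumes R: "fi_corr V Z B W Z' B' R" and S: "fi_corr W Z' B' U Z'' B'' S"
  shows "fi_corr V Z B U Z'' B'' (\<lambda>X x z. \<exists>y. R X x y \<and> S X y z)"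
proof (rule fi_corrI, goal_cases)
  case (1 X x y)
  then show ?case
    using fi_corr_mem[OF R 1(1)] fi_corr_mem[OF S 1(1)] fi_corr_bounds[OF R 1(1)]
      fi_corr_bounds[OF S 1(1)] by blast
next
  case (2 X x)
  then show ?case
    using fi_corr_left[OF R 2(1)] fi_corr_mem[OF R 2(1)] fi_corr_left[OF S 2(1)] by blast
next
  case (3 X y)
  then show ?case
    using fi_corr_right[OF S 3(1)] fi_corr_mem[OF S 3(1)] fi_corr_right[OF R 3(1)] by blast
next
  case (4 X x y x' y')
  then show ?case
    using fi_corr_add[OF R 4(1)] fi_corr_add[OF S 4(1)] by blast
next
  case (5 X r x y)
  then show ?case
    using fi_corr_smul[OF R 5(1)] fi_corr_smul[OF S 5(1)] by blast
next
  case (6 X Y \<alpha> x y)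
  then show ?case
    using fi_corr_natural[OF R 6(1)] fi_corr_natural[OF S 6(1)] by blast
qed

lemma fi_isomorphic_subquotients:
  assumes V: "fi_premodule V" "fi_stable V Z" "fi_stable V B" "\<And>X. finite X \<Longrightarrow> B X \<subseteq> Z X"
    and W: "fi_premodule W" "fi_stable W Z'" "fi_stable W B'" "\<And>X. finite X \<Longrightarrow> B' X \<subseteq> Z' X"
    and R: "fi_corr V Z B W Z' B' R"
  shows "fi_isomorphic (fi_quot (fi_sub V Z) B) (fi_quot (fi_sub W Z') B')"
proof -
  define M where "M X = (fobj V X)\<lparr>carr := Z X\<rparr>" for X
  define N where "N X = (fobj W X)\<lparr>carr := Z' X\<rparr>" for X
  have M: "is_rmod (M X)" "rsubmod (M X) (B X)" if "finite X" for X
    using V(1-3) V(4)[OF that] is_rmod_restrict[OF fi_premodule_rmod fi_stable_rsubmod] that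
      fi_stable_rsubmod[OF V(3) that]
    by (auto simp: M_def rsubmod_def)
  have N: "is_rmod (N X)" "rsubmod (N X) (B' X)" if "finite X" for X
    using W(1-3) W(4)[OF that] is_rmod_restrict[OF fi_premodule_rmod fi_stable_rsubmod] that
      fi_stable_rsubmod[OF W(3) that]
    by (auto simp: N_def rsubmod_def)
  have Mmor: "rlinear (M X) (M Y) (fmor V X Y \<alpha>)" if "fi_inj X Y \<alpha>" for X Y \<alpha>
    using fi_premodule_mor[OF V(1) that] fi_stable_mor[OF V(2) that]
      rsubmod_subset[OF fi_stable_rsubmod[OF V(2)]] fi_inj_finite[OF that]
    by (auto simp: rlinear_def M_def)
  have Nmor: "rlinear (N X) (N Y) (fmor W X Y \<alpha>)" if "fi_inj X Y \<alpha>" for X Y \<alpha>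
    using fi_premodule_mor[OF W(1) that] fi_stable_mor[OF W(2) that]
      rsubmod_subset[OF fi_stable_rsubmod[OF W(2)]] fi_inj_finite[OF that]
    by (auto simp: rlinear_def N_def)
  have carr: "carr (M X) = Z X" "carr (N X) = Z' X" for X
    by (simp_all add: M_def N_def)
  have Radd: "R X (madd (M X) x x') (madd (N X) y y')"
    if "finite X" "R X x y" "R X x' y'" for X x y x' y'
    using fi_corr_add[OF R that] by (simp add: M_def N_def)
  have Rsmul: "R X (msmul (M X) r x) (msmul (N X) r y)" if "finite X" "R X x y" for X r x y
    using fi_corr_smul[OF R that] by (simp add: M_def N_def)
  have Rmem: "x \<in> carr (M X)" "y \<in> carr (N X)" if "finite X" "R X x y" for X x y
    using fi_corr_mem[OF R that] by (simp_all add: carr)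
  \<comment> \<open>The choice ranges over the partners of all members of A, so no representative of
    A has to be fixed; by \<open>coset_iff\<close> the resulting coset does not depend on the
    choice.\<close>
  define \<phi> where "\<phi> X A = rcoset (N X) (B' X) (SOME y. \<exists>x\<in>A. R X x y)" for X A
  \<comment> \<open>The difference of two related pairs is related, and related elements lie in
    \<open>B\<close> and \<open>B'\<close> simultaneously. One direction is well-definedness of the
    induced map, the other its injectivity.\<close>
  have coset_iff: "rcoset (M X) (B X) x = rcoset (M X) (B X) x' \<longleftrightarrow>
      rcoset (N X) (B' X) y = rcoset (N X) (B' X) y'"
    if X: "finite X" and xy: "R X x y" "R X x' y'" for X x y x' y'
    using fi_corr_bounds[OF R X Radd[OF X xy(1) Rsmul[OF X xy(2)]]]
      rcoset_eq_iff[OF M[OF X]] rcoset_eq_iff[OF N[OF X]] Rmem[OF X xy(1)] Rmem[OF X xy(2)] by simp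
  have \<phi>: "\<phi> X (rcoset (M X) (B X) x) = rcoset (N X) (B' X) y" if X: "finite X" and xy: "R X x y" for X x y
  proof -
    define y' where "y' = (SOME y. \<exists>x'\<in>rcoset (M X) (B X) x. R X x' y)"
    have "\<exists>y. \<exists>x'\<in>rcoset (M X) (B X) x. R X x' y"
      using xy rcoset_self[OF M[OF X] Rmem(1)[OF X xy]] by blast
    then have "\<exists>x'\<in>rcoset (M X) (B X) x. R X x' y'"
      unfolding y'_def by (rule someI_ex)
    then obtain x' where x': "x' \<in> rcoset (M X) (B X) x" "R X x' y'"
      by blast
    then have "rcoset (M X) (B X) x' = rcoset (M X) (B X) x"
      using mem_rcoset_eq[OF M[OF X] Rmem(1)[OF X xy]] by simp
    then show ?thesis
      using coset_iff[OF X x'(2) xy] by (simp add: \<phi>_def y'_def)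
  qed
  have left: "\<exists>y. R X x y" if "finite X" "x \<in> carr (M X)" for X x
    using fi_corr_left[OF R that(1)] that(2) by (simp add: carr)
  have right: "\<exists>x. R X x y" if "finite X" "y \<in> carr (N X)" for X y
    using fi_corr_right[OF R that(1)] that(2) by (simp add: carr)
  have lin: "rlinear (rquot (M X) (B X)) (rquot (N X) (B' X)) (\<phi> X)" if X: "finite X" for X
    unfolding rlinear_def rquot_carr
  proof (intro conjI ballI allI; clarify)
    fix x
    assume "x \<in> carr (M X)"
    then obtain y where xy: "R X x y"
      using left X by blast
    show "\<phi> X (rcoset (M X) (B X) x) \<in> rcoset (N X) (B' X) ` carr (N X)"
      using \<phi>[OF X xy] Rmem[OF X xy] by simp
    show "\<phi> X (msmul (rquot (M X) (B X)) r (rcoset (M X) (B X) x)) =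
        msmul (rquot (N X) (B' X)) r (\<phi> X (rcoset (M X) (B X) x))" for r
      using \<phi>[OF X xy] \<phi>[OF X Rsmul[OF X xy]] Rmem[OF X xy]
      by (simp add: rquot_msmul_rcoset M[OF X] N[OF X])
    fix x'
    assume "x' \<in> carr (M X)"
    then obtain y' where xy': "R X x' y'"
      using left X by blast
    show "\<phi> X (madd (rquot (M X) (B X)) (rcoset (M X) (B X) x) (rcoset (M X) (B X) x')) =
        madd (rquot (N X) (B' X)) (\<phi> X (rcoset (M X) (B X) x)) (\<phi> X (rcoset (M X) (B X) x'))"
      using \<phi>[OF X xy] \<phi>[OF X xy'] \<phi>[OF X Radd[OF X xy xy']] Rmem[OF X xy] Rmem[OF X xy']
      by (simp add: rquot_madd_rcoset M[OF X] N[OF X])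
  qed
  have nat: "\<phi> Y (qmap (M Y) (B Y) (fmor V X Y \<alpha>) A) = qmap (N Y) (B' Y) (fmor W X Y \<alpha>) (\<phi> X A)"
    if \<alpha>: "fi_inj X Y \<alpha>" and A: "A \<in> carr (rquot (M X) (B X))" for X Y \<alpha> A
  proof -
    have X: "finite X" and Y: "finite Y"
      using fi_inj_finite[OF \<alpha>] by auto
    obtain x where x: "x \<in> carr (M X)" "A = rcoset (M X) (B X) x"
      using A by (auto simp: rquot_carr)
    then obtain y where xy: "R X x y"
      using left X by blast
    show ?thesis
      unfolding x(2) \<phi>[OF X xy]
        qmap_rcoset[OF M[OF X] M[OF Y] Mmor[OF \<alpha>] fi_stable_mor[OF V(3) \<alpha>] x(1)]
        qmap_rcoset[OF N[OF X] N[OF Y] Nmor[OF \<alpha>] fi_stable_mor[OF W(3) \<alpha>] Rmem(2)[OF X xy]]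
      by (rule \<phi>[OF Y fi_corr_natural[OF R \<alpha> xy]])
  qed
  have bij: "bij_betw (\<phi> X) (carr (rquot (M X) (B X))) (carr (rquot (N X) (B' X)))"
    if X: "finite X" for X
    unfolding bij_betw_def
  proof
    show "inj_on (\<phi> X) (carr (rquot (M X) (B X)))"
    proof (rule inj_onI)
      fix A A'
      assume "A \<in> carr (rquot (M X) (B X))" "A' \<in> carr (rquot (M X) (B X))"
      then obtain x x' where x: "x \<in> carr (M X)" "A = rcoset (M X) (B X) x"
          "x' \<in> carr (M X)" "A' = rcoset (M X) (B X) x'"
        by (auto simp: rquot_carr)
      then obtain y y' where xy: "R X x y" "R X x' y'"
        using left[OF X] by blast
      assume "\<phi> X A = \<phi> X A'"
      then show "A = A'"
        using \<phi>[OF X xy(1)] \<phi>[OF X xy(2)] coset_iff[OF X xy] x by simp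
    qed
    show "\<phi> X ` carr (rquot (M X) (B X)) = carr (rquot (N X) (B' X))"
    proof
      show "\<phi> X ` carr (rquot (M X) (B X)) \<subseteq> carr (rquot (N X) (B' X))"
        using rlinear_closed[OF lin[OF X]] by blast
      show "carr (rquot (N X) (B' X)) \<subseteq> \<phi> X ` carr (rquot (M X) (B X))"
      proof
        fix C
        assume "C \<in> carr (rquot (N X) (B' X))"
        then obtain y where "y \<in> carr (N X)" "C = rcoset (N X) (B' X) y"
          by (auto simp: rquot_carr)
        moreover from this obtain x where "R X x y"
          using right[OF X] by blast
        ultimately show "C \<in> \<phi> X ` carr (rquot (M X) (B X))"
          using \<phi>[OF X] Rmem[OF X] by (metis image_eqI rquot_carr)
      qed
    qed
  qed
  have "fi_iso (fi_quot (fi_sub V Z) B) (fi_quot (fi_sub W Z') B') \<phi>"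
    unfolding fi_iso_def fi_hom_def fi_quot_def fi_sub_def
    using lin nat bij by (simp add: M_def N_def)
  then show ?thesis
    unfolding fi_isomorphic_def by blast
qed

subsection \<open>Exact double complexes\<close>

text \<open>Exactness is imposed only in positive degree of the direction concerned; the cokernels
  along the two edges are described later by augmentations.\<close>

locale exact_double_complex =
  fixes D :: "nat \<Rightarrow> nat \<Rightarrow> ('r::comm_ring_1, 'd) fimod"
    and d e :: "nat \<Rightarrow> nat \<Rightarrow> nat set \<Rightarrow> 'd \<Rightarrow> 'd"
  assumes premodule: "\<And>i j. fi_premodule (D i j)"
    and d_hom: "\<And>i j. fi_hom (D (Suc i) j) (D i j) (d i j)"
    and e_hom: "\<And>i j. fi_hom (D i (Suc j)) (D i j) (e i j)"
    and comm: "\<And>i j X x. finite X \<Longrightarrow> x \<in> carr (fobj (D (Suc i) (Suc j)) X) \<Longrightarrow>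
      d i j X (e (Suc i) j X x) = e i j X (d i (Suc j) X x)"
    and d_exact: "\<And>i j X. finite X \<Longrightarrow>
      {x \<in> carr (fobj (D (Suc i) j) X). d i j X x = mzero (fobj (D i j) X)}
        = d (Suc i) j X ` carr (fobj (D (Suc (Suc i)) j) X)"
    and e_exact: "\<And>i j X. finite X \<Longrightarrow>
      {x \<in> carr (fobj (D i (Suc j)) X). e i j X x = mzero (fobj (D i j) X)}
        = e i (Suc j) X ` carr (fobj (D i (Suc (Suc j))) X)"
begin

abbreviation DX where "DX i j X \<equiv> fobj (D i j) X"
abbreviation im_d where "im_d i j X \<equiv> d i j X ` carr (DX (Suc i) j X)"
abbreviation im_e where "im_e i j X \<equiv> e i j X ` carr (DX i (Suc j) X)"

text \<open>The elements that can be moved along the antidiagonal: d x = e y for some y, and e x = d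
  z for some z, each wherever the target exists. On the edge j = 0, \<open>Z\<close> modulo
  \<open>B\<close> is the homology of the cokernels of e; on the edge i = 0, that of the cokernels
  of d.\<close>

definition Z :: "nat \<Rightarrow> nat \<Rightarrow> nat set \<Rightarrow> 'd set" where
  "Z i j X = {x \<in> carr (DX i j X). (\<forall>k. i = Suc k \<longrightarrow> d k j X x \<in> im_e k j X) \<and>
     (\<forall>k. j = Suc k \<longrightarrow> e i k X x \<in> im_d i k X)}"

definition B :: "nat \<Rightarrow> nat \<Rightarrow> nat set \<Rightarrow> 'd set" where
  "B i j X = {x. \<exists>k\<in>im_d i j X. \<exists>l\<in>im_e i j X. x = madd (DX i j X) k l}"

lemma rmod: "finite X \<Longrightarrow> is_rmod (DX i j X)"
  using fi_premodule_rmod premodule by blast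

lemma d_lin: "finite X \<Longrightarrow> rlinear (DX (Suc i) j X) (DX i j X) (d i j X)"
  using fi_hom_linear d_hom by blast

lemma e_lin: "finite X \<Longrightarrow> rlinear (DX i (Suc j) X) (DX i j X) (e i j X)"
  using fi_hom_linear e_hom by blast

text \<open>The axioms are symmetric in d and e, so a fact about one side of a zigzag step gives the
  fact about the other side.\<close>

lemma transpose: "exact_double_complex (\<lambda>i j. D j i) (\<lambda>i j. e j i) (\<lambda>i j. d j i)"
  by standard (simp_all add: premodule d_hom e_hom comm d_exact e_exact)

lemma Z_transpose: "exact_double_complex.Z (\<lambda>i j. D j i) (\<lambda>i j. e j i) (\<lambda>i j. d j i) j i X = Z i j X"
  by (auto simp: exact_double_complex.Z_def[OF transpose] Z_def)

text \<open>Transposing swaps the two summands in \<open>B\<close>, so commutativity of addition is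
  used, which is available at finite X.\<close>

lemma B_transpose:
  assumes X: "finite X"
  shows "exact_double_complex.B (\<lambda>i j. D j i) (\<lambda>i j. e j i) (\<lambda>i j. d j i) j i X = B i j X"
  using rmod_comm[OF rmod[OF X]] rlinear_closed[OF d_lin[OF X]] rlinear_closed[OF e_lin[OF X]]
  by (fastforce simp: exact_double_complex.B_def[OF transpose] B_def)

text \<open>Since d x is in the image of e, e d x = 0; hence d e x = 0 and exactness of d applies.
  With the transposed statement, the two conditions in \<open>Z\<close> are equivalent whenever both
  indices are positive.\<close>

lemma d_im_e_imp_e_im_d:
  assumes X: "finite X" and x: "x \<in> carr (DX (Suc i) (Suc j) X)"
    and dx: "d i (Suc j) X x \<in> im_e i (Suc j) X"
  shows "e (Suc i) j X x \<in> im_d (Suc i) j X"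
  unfolding d_exact[OF X, symmetric] using dx[folded e_exact[OF X]] x
  by (simp add: comm[OF X] rlinear_closed[OF e_lin[OF X]])

text \<open>Write x = k + e m with k in the image of d. Then e y = d x = d e m = e d m, so y - d m
  is killed by e and lies in the image of e.\<close>

lemma step_bounds:
  assumes X: "finite X" and x: "x \<in> carr (DX (Suc i) j X)" and y: "y \<in> carr (DX i (Suc j) X)"
    and eq: "d i j X x = e i j X y" and xB: "x \<in> B (Suc i) j X"
  shows "y \<in> B i (Suc j) X"
proof -
  from xB obtain k l where k: "k \<in> im_d (Suc i) j X" and l: "l \<in> im_e (Suc i) j X"
    and xkl: "x = madd (DX (Suc i) j X) k l"
    by (auto simp: B_def)
  have k': "k \<in> carr (DX (Suc i) j X)" "d i j X k = mzero (DX i j X)"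
    using k[folded d_exact[OF X]] by auto
  obtain m where m: "m \<in> carr (DX (Suc i) (Suc j) X)" and lm: "l = e (Suc i) j X m"
    using l by blast
  note dc = rlinear_closed[OF d_lin[OF X]] and ec = rlinear_closed[OF e_lin[OF X]]
  have "d i j X x = d i j X l"
    using k' m by (simp add: xkl lm rlinear_add[OF d_lin[OF X]] ec dc rmod_zero_add[OF rmod[OF X]])
  then have ey: "e i j X y = e i j X (d i (Suc j) X m)"
    using eq comm[OF X m] lm by simp
  define n where "n = msub (DX i (Suc j) X) y (d i (Suc j) X m)"
  have "n \<in> im_e i (Suc j) X"
    unfolding e_exact[OF X, symmetric] n_def
    using ey y dc[OF m] rlinear_eq_iff[OF rmod[OF X] rmod[OF X] e_lin[OF X] y dc[OF m]]
    by (simp add: rmod_closed[OF rmod[OF X]])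
  moreover have "y = madd (DX i (Suc j) X) (d i (Suc j) X m) n"
    unfolding n_def using rmod_sub_add[OF rmod[OF X] y dc[OF m]] by simp
  ultimately show ?thesis
    using m by (auto simp: B_def)
qed

text \<open>Both \<open>x\<close> and \<open>y\<close> are mapped to the same element of \<open>D i j\<close>: one step of the zigzag.\<close>
definition step :: "nat \<Rightarrow> nat \<Rightarrow> nat set \<Rightarrow> 'd \<Rightarrow> 'd \<Rightarrow> bool" where
  "step i j X x y \<longleftrightarrow> x \<in> carr (DX (Suc i) j X) \<and> y \<in> carr (DX i (Suc j) X) \<and> d i j X x = e i j X y"

lemma step_Z:
  assumes X: "finite X" and xy: "step i j X x y"
  shows "x \<in> Z (Suc i) j X"
proof -
  have "e (Suc i) k X x \<in> im_d (Suc i) k X" if "j = Suc k" for k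
    using d_im_e_imp_e_im_d[OF X, of x i k] xy that by (auto simp: step_def)
  then show ?thesis
    using xy by (auto simp: Z_def step_def)
qed

lemma step_transpose:
  "exact_double_complex.step (\<lambda>i j. D j i) (\<lambda>i j. e j i) (\<lambda>i j. d j i) j i X y x \<longleftrightarrow> step i j X x y"
  by (auto simp: exact_double_complex.step_def[OF transpose] step_def)

lemma fi_corr_step:
  "fi_corr (D (Suc i) j) (Z (Suc i) j) (B (Suc i) j) (D i (Suc j)) (Z i (Suc j)) (B i (Suc j)) (step i j)"
proof (rule fi_corrI, goal_cases)
  case (1 X x y)
  note T = exact_double_complex.step_bounds[OF transpose, of X y i j x]
    exact_double_complex.step_Z[OF transpose, of X j i y x]
  show ?case
    using 1 step_Z[OF 1] step_bounds[OF 1(1), of x i j y] T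
    by (auto simp: step_transpose Z_transpose B_transpose step_def)
next
  case (2 X x)
  then show ?case
    by (auto simp: Z_def step_def)
next
  case (3 X y)
  then show ?case
    by (force simp: Z_def step_def)
next
  case (4 X x y x' y')
  then show ?case
    by (simp add: step_def rmod rmod_closed rlinear_add[OF d_lin] rlinear_add[OF e_lin])
next
  case (5 X r x y)
  then show ?case
    by (simp add: step_def rmod rmod_closed rlinear_smul[OF d_lin] rlinear_smul[OF e_lin])
next
  case (6 X Y \<alpha> x y)
  then show ?case
    using fi_hom_natural[OF d_hom 6(1)] fi_hom_natural[OF e_hom 6(1)]
      rlinear_closed[OF fi_premodule_mor[OF premodule 6(1)]]
    by (simp add: step_def)
qed

text \<open>Each step lowers the first index and raises the second. The induction is general in j
  and R because both change when a step is appended.\<close>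

lemma zigzag:
  assumes "fi_corr W U T (D (i + n) j) (Z (i + n) j) (B (i + n) j) R"
  shows "\<exists>R. fi_corr W U T (D i (j + n)) (Z i (j + n)) (B i (j + n)) R"
  using assms
proof (induction n arbitrary: j R)
  case 0
  then show ?case
    by auto
next
  case (Suc n)
  have "fi_corr W U T (D (i + n) (Suc j)) (Z (i + n) (Suc j)) (B (i + n) (Suc j))
      (\<lambda>X x z. \<exists>y. R X x y \<and> step (i + n) j X y z)"
    using fi_corr_trans[OF Suc.prems[unfolded add_Suc_right] fi_corr_step] .
  from Suc.IH[OF this] show ?case
    by simp
qed

end

section \<open>Augmentations and the comparison of the two edges\<close>

locale augmented_double_complex = exact_double_complex D d e
  for D :: "nat \<Rightarrow> nat \<Rightarrow> ('r::comm_ring_1, 'd) fimod" and d e +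
  fixes C :: "nat \<Rightarrow> ('r, 'c) fimod"
    and dC :: "nat \<Rightarrow> nat set \<Rightarrow> 'c \<Rightarrow> 'c"
    and \<epsilon> :: "nat \<Rightarrow> nat set \<Rightarrow> 'd \<Rightarrow> 'c"
  assumes C_premodule: "\<And>i. fi_premodule (C i)"
    and dC_hom: "\<And>i. fi_hom (C (Suc i)) (C i) (dC i)"
    and \<epsilon>_hom: "\<And>i. fi_hom (D i 0) (C i) (\<epsilon> i)"
    and \<epsilon>_surj: "\<And>i X. finite X \<Longrightarrow> \<epsilon> i X ` carr (fobj (D i 0) X) = carr (fobj (C i) X)"
    and \<epsilon>_ker: "\<And>i X. finite X \<Longrightarrow>
      {x \<in> carr (fobj (D i 0) X). \<epsilon> i X x = mzero (fobj (C i) X)} = e i 0 X ` carr (fobj (D i 1) X)"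
    and \<epsilon>_comm: "\<And>i X x. finite X \<Longrightarrow> x \<in> carr (fobj (D (Suc i) 0) X) \<Longrightarrow>
      dC i X (\<epsilon> (Suc i) X x) = \<epsilon> i X (d i 0 X x)"
begin

lemma C_rmod: "finite X \<Longrightarrow> is_rmod (fobj (C i) X)"
  using fi_premodule_rmod C_premodule by blast

lemma \<epsilon>_lin: "finite X \<Longrightarrow> rlinear (DX i 0 X) (fobj (C i) X) (\<epsilon> i X)"
  using fi_hom_linear \<epsilon>_hom by blast

text \<open>C is a quotient of D along \<epsilon>, so d d = 0 descends from D. For the complex of V
  this takes the place of a direct computation.\<close>

lemma dC_dC:
  assumes X: "finite X" and x: "x \<in> carr (fobj (C (Suc (Suc i))) X)"
  shows "dC i X (dC (Suc i) X x) = mzero (fobj (C i) X)"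
proof -
  obtain y where y: "y \<in> carr (DX (Suc (Suc i)) 0 X)" "x = \<epsilon> (Suc (Suc i)) X y"
    using x \<epsilon>_surj[OF X] by blast
  then have "d i 0 X (d (Suc i) 0 X y) = mzero (DX i 0 X)" "d (Suc i) 0 X y \<in> carr (DX (Suc i) 0 X)"
    using d_exact[OF X, of i 0] by auto
  then show ?thesis
    using y by (simp add: \<epsilon>_comm[OF X] rlinear_zero[OF rmod[OF X] C_rmod[OF X] \<epsilon>_lin[OF X]])
qed

lemma bounds_subset_cycles: "finite X \<Longrightarrow> cx_bounds C dC a X \<subseteq> cx_cycles C dC a X"
  using dC_dC rlinear_closed[OF fi_hom_linear[OF dC_hom]]
  by (cases a) (auto simp: cx_bounds_def cx_cycles_def)

lemma fi_stable_cycles: "fi_stable (C a) (cx_cycles C dC a)"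
proof (cases a)
  case 0
  then show ?thesis
    using C_premodule[of 0]
    by (auto simp: fi_stable_def cx_cycles_def C_rmod rsubmod_carr dest: fi_premodule_mor rlinear_closed)
next
  case (Suc k)
  then have *: "cx_cycles C dC a = (\<lambda>X. {x \<in> carr (fobj (C a) X). dC k X x = mzero (fobj (C k) X)})"
    by (simp add: cx_cycles_def fun_eq_iff)
  show ?thesis
    unfolding * unfolding Suc by (rule fi_stable_kernel[OF C_premodule C_premodule dC_hom])
qed

lemma fi_stable_bounds: "fi_stable (C a) (cx_bounds C dC a)"
  unfolding cx_bounds_def by (rule fi_stable_image[OF C_premodule C_premodule dC_hom])

text \<open>If \<epsilon> x = dC c, lift c to k along \<epsilon>; then x - d k is killed by
  \<epsilon> and so lies in the image of e. Conversely \<epsilon> kills the e-part of an element of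
  \<open>B\<close>.\<close>

lemma \<epsilon>_bounds:
  assumes X: "finite X" and x: "x \<in> carr (DX a 0 X)"
  shows "x \<in> B a 0 X \<longleftrightarrow> \<epsilon> a X x \<in> cx_bounds C dC a X"
proof
  assume "x \<in> B a 0 X"
  then obtain k l where k: "k \<in> carr (DX (Suc a) 0 X)" and l: "l \<in> im_e a 0 X"
    and xkl: "x = madd (DX a 0 X) (d a 0 X k) l"
    by (auto simp: B_def)
  have "\<epsilon> a X x = \<epsilon> a X (d a 0 X k)"
    unfolding xkl using k l[unfolded One_nat_def[symmetric], folded \<epsilon>_ker[OF X]]
    by (simp add: rlinear_add[OF \<epsilon>_lin[OF X]] rlinear_closed[OF d_lin[OF X]]
        rlinear_closed[OF \<epsilon>_lin[OF X]] rmod_add_zero[OF C_rmod[OF X]])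
  then show "\<epsilon> a X x \<in> cx_bounds C dC a X"
    using \<epsilon>_comm[OF X k] rlinear_closed[OF \<epsilon>_lin[OF X] k] by (metis cx_bounds_def image_eqI)
next
  assume "\<epsilon> a X x \<in> cx_bounds C dC a X"
  then obtain c where "c \<in> carr (fobj (C (Suc a)) X)" "\<epsilon> a X x = dC a X c"
    by (auto simp: cx_bounds_def)
  moreover from this obtain k where k: "k \<in> carr (DX (Suc a) 0 X)" "c = \<epsilon> (Suc a) X k"
    using \<epsilon>_surj[OF X] by blast
  ultimately have k: "k \<in> carr (DX (Suc a) 0 X)" "\<epsilon> a X x = \<epsilon> a X (d a 0 X k)"
    using \<epsilon>_comm[OF X] by simp_all
  define l where "l = msub (DX a 0 X) x (d a 0 X k)"
  note dk = rlinear_closed[OF d_lin[OF X] k(1)]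
  have "l \<in> im_e a 0 X"
    unfolding One_nat_def[symmetric] \<epsilon>_ker[OF X, symmetric] l_def using x dk k(2)
      rlinear_eq_iff[OF rmod[OF X] C_rmod[OF X] \<epsilon>_lin[OF X] x dk]
    by (simp add: rmod_closed[OF rmod[OF X]])
  moreover have "x = madd (DX a 0 X) (d a 0 X k) l"
    unfolding l_def using rmod_sub_add[OF rmod[OF X] x dk] by simp
  ultimately show "x \<in> B a 0 X"
    using k by (auto simp: B_def)
qed

text \<open>dC \<epsilon> x = \<epsilon> d x vanishes exactly when d x is in the kernel of
  \<epsilon>, which is the image of e. In degree zero neither side imposes a condition.\<close>

lemma \<epsilon>_cycles:
  assumes X: "finite X" and x: "x \<in> carr (DX a 0 X)"
  shows "x \<in> Z a 0 X \<longleftrightarrow> \<epsilon> a X x \<in> cx_cycles C dC a X"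
proof (cases a)
  case 0
  then show ?thesis
    using x by (simp add: Z_def cx_cycles_def rlinear_closed[OF \<epsilon>_lin[OF X]])
next
  case (Suc k)
  then have "d k 0 X x \<in> im_e k 0 X \<longleftrightarrow> dC k X (\<epsilon> a X x) = mzero (fobj (C k) X)"
    using x \<epsilon>_comm[OF X, of x k] \<epsilon>_ker[OF X, of k] rlinear_closed[OF d_lin[OF X], of x k 0]
    by (auto simp: set_eq_iff)
  then show ?thesis
    using x Suc by (simp add: Z_def cx_cycles_def rlinear_closed[OF \<epsilon>_lin[OF X]])
qed

lemma fi_corr_augmentation:
  "fi_corr (C a) (cx_cycles C dC a) (cx_bounds C dC a) (D a 0) (Z a 0) (B a 0)
     (\<lambda>X c x. x \<in> Z a 0 X \<and> c = \<epsilon> a X x)"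
proof (rule fi_corrI, goal_cases)
  case (1 X c x)
  then show ?case
    using \<epsilon>_cycles[OF 1(1)] \<epsilon>_bounds[OF 1(1)] by (auto simp: Z_def)
next
  case (2 X c)
  then obtain x where "x \<in> carr (DX a 0 X)" "c = \<epsilon> a X x"
    using \<epsilon>_surj[OF 2(1)] rsubmod_subset[OF fi_stable_rsubmod[OF fi_stable_cycles 2(1)]] by blast
  then show ?case
    using \<epsilon>_cycles[OF 2(1)] 2(2) by auto
next
  case (3 X x)
  then show ?case
    by auto
next
  case (4 X c x c' x')
  then have "x \<in> carr (DX a 0 X)" "x' \<in> carr (DX a 0 X)"
    by (auto simp: Z_def)
  then show ?case
    using 4 \<epsilon>_cycles[OF 4(1)] rsubmod_add[OF fi_stable_rsubmod[OF fi_stable_cycles 4(1)]]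
    by (simp add: rlinear_add[OF \<epsilon>_lin[OF 4(1)]] rmod_closed[OF rmod[OF 4(1)]])
next
  case (5 X r c x)
  then have "x \<in> carr (DX a 0 X)"
    by (auto simp: Z_def)
  then show ?case
    using 5 \<epsilon>_cycles[OF 5(1)] rsubmod_smul[OF fi_stable_rsubmod[OF fi_stable_cycles 5(1)]]
    by (simp add: rlinear_smul[OF \<epsilon>_lin[OF 5(1)]] rmod_closed[OF rmod[OF 5(1)]])
next
  case (6 X Y \<alpha> c x)
  have XY: "finite X" "finite Y"
    using fi_inj_finite[OF 6(1)] by auto
  have x: "x \<in> carr (DX a 0 X)"
    using 6 by (auto simp: Z_def)
  have "fmor (C a) X Y \<alpha> (\<epsilon> a X x) \<in> cx_cycles C dC a Y"
    using 6 x \<epsilon>_cycles[OF XY(1) x]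
    by (intro subsetD[OF fi_stable_mor[OF fi_stable_cycles 6(1)]] imageI) simp
  then show ?case
    using 6 \<epsilon>_cycles[OF XY(2)] fi_hom_natural[OF \<epsilon>_hom 6(1) x]
      rlinear_closed[OF fi_premodule_mor[OF premodule 6(1)] x]
    by simp
qed

end

text \<open>The relations are chained from C a through D a 0, then along the antidiagonal to D 0 a,
  and from there to C' a.\<close>

theorem double_complex_homology:
  assumes rows: "augmented_double_complex D d e C dC \<epsilon>"
    and cols: "augmented_double_complex (\<lambda>i j. D j i) (\<lambda>i j. e j i) (\<lambda>i j. d j i) C' dC' \<epsilon>'"
  shows "fi_isomorphic (fi_homology C' dC' a) (fi_homology C dC a)"
proof -
  interpret R: augmented_double_complex D d e C dC \<epsilon> by (rule rows)
  interpret L: augmented_double_complex "\<lambda>i j. D j i" "\<lambda>i j. e j i" "\<lambda>i j. d j i" C' dC' \<epsilon>'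
    by (rule cols)
  obtain S where "fi_corr (C a) (cx_cycles C dC a) (cx_bounds C dC a)
      (D 0 a) (R.Z 0 a) (R.B 0 a) S"
    using R.zigzag[of "C a" "cx_cycles C dC a" "cx_bounds C dC a" 0 a 0] R.fi_corr_augmentation[of a]
    by (simp only: add_0) blast
  \<comment> \<open>The transposed locale has its own copies of \<open>Z\<close> and
    \<open>B\<close>. Those of \<open>Z\<close> are equal as functions, those of \<open>B\<close>
    are identified at finite X only, hence \<open>fi_corr_cong\<close> below.\<close>
  moreover have Z: "L.Z a 0 = R.Z 0 a"
    by (rule ext) (rule R.Z_transpose)
  have "fi_corr (D 0 a) (R.Z 0 a) (R.B 0 a) (C' a) (cx_cycles C' dC' a) (cx_bounds C' dC' a)
      (\<lambda>X x c. x \<in> R.Z 0 a X \<and> c = \<epsilon>' a X x)"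
    using fi_corr_sym[OF L.fi_corr_augmentation[of a]] unfolding Z
    by (rule fi_corr_cong) (simp_all add: R.B_transpose)
  ultimately have "fi_corr (C' a) (cx_cycles C' dC' a) (cx_bounds C' dC' a)
      (C a) (cx_cycles C dC a) (cx_bounds C dC a)
      (\<lambda>X c c'. \<exists>x. S X c' x \<and> x \<in> R.Z 0 a X \<and> c = \<epsilon>' a X x)"
    by (rule fi_corr_sym[OF fi_corr_trans])
  then show ?thesis
    unfolding fi_homology_def
    by (intro fi_isomorphic_subquotients R.C_premodule L.C_premodule R.fi_stable_cycles
        L.fi_stable_cycles R.fi_stable_bounds L.fi_stable_bounds R.bounds_subset_cycles
        L.bounds_subset_cycles)
qed

subsection \<open>Finite sums in modules\<close>

lemma msum_empty [simp]: "msum M f {} = mzero M"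
  by (simp add: msum_def)

lemma msum_insert:
  assumes M: "is_rmod M" and A: "finite A" "x \<notin> A" and fx: "f x \<in> carr M"
    and fA: "\<And>i. i \<in> A \<Longrightarrow> f i \<in> carr M"
  shows "msum M f (insert x A) = madd M (f x) (msum M f A)"
proof -
  have f: "f i \<in> carr M" if "i \<in> insert x A" for i
    using that fx fA by auto
  \<comment> \<open>\<open>fold\<close> wants the steps to commute at every accumulator, whereas
    \<open>madd M\<close> is known to be commutative and associative on the carrier only. Acting as
    the identity off the carrier repairs this without changing the sum.\<close>
  define g where "g i acc = (if acc \<in> carr M then madd M (f i) acc else acc)" for i acc
  have eq: "msum M f A' = Finite_Set.fold g (mzero M) A'" if "A' \<subseteq> insert x A" for A'
    unfolding msum_def using that f M
    by (intro fold_closed_eq[where B = "carr M"]) (auto simp: g_def rmod_closed)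
  have gc: "g i acc \<in> carr M" if "i \<in> insert x A" "acc \<in> carr M" for i acc
    using that f M by (simp add: g_def rmod_closed)
  interpret comp_fun_commute_on "insert x A" g
    using f M by unfold_locales (auto simp: g_def fun_eq_iff rmod_closed rmod_lcomm)
  have "Finite_Set.fold g (mzero M) A' \<in> carr M" if "finite A'" "A' \<subseteq> insert x A" for A'
    using that
  proof (induction A' rule: finite_induct)
    case (insert y A')
    then have "Finite_Set.fold g (mzero M) (insert y A') = g y (Finite_Set.fold g (mzero M) A')"
      by (intro fold_insert) auto
    then show ?case
      using insert gc by auto
  qed (simp add: M rmod_closed)
  then show ?thesis
    using A by (simp add: eq subset_insertI fold_insert) (simp add: g_def subset_insertI)
qed

lemma msum_closed: "is_rmod M \<Longrightarrow> (\<And>i. i \<in> A \<Longrightarrow> f i \<in> carr M) \<Longrightarrow> msum M f A \<in> carr M"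
proof (induction A rule: infinite_finite_induct)
  case (infinite A)
  then show ?case
    by (simp add: msum_def rmod_closed)
qed (simp_all add: msum_insert rmod_closed)

lemma msum_cong:
  assumes "is_rmod M" "\<And>i. i \<in> A \<Longrightarrow> f i = g i" "\<And>i. i \<in> A \<Longrightarrow> g i \<in> carr M"
  shows "msum M f A = msum M g A"
  using assms
proof (induction A rule: infinite_finite_induct)
  case (infinite A)
  then show ?case
    by (simp add: msum_def)
qed (simp_all add: msum_insert)

lemma msum_all_zero: "is_rmod M \<Longrightarrow> (\<And>i. i \<in> A \<Longrightarrow> f i = mzero M) \<Longrightarrow> msum M f A = mzero M"
proof (induction A rule: infinite_finite_induct)
  case (infinite A)
  then show ?case
    by (simp add: msum_def)
qed (simp_all add: msum_insert rmod_closed rmod_zero_add)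

lemma msum_union:
  assumes "is_rmod M" "finite A" "finite A'" "A \<inter> A' = {}" "\<And>i. i \<in> A \<union> A' \<Longrightarrow> f i \<in> carr M"
  shows "msum M f (A \<union> A') = madd M (msum M f A) (msum M f A')"
  using assms(2,4,5)
proof (induction A rule: finite_induct)
  case empty
  then show ?case
    using assms(1) by (simp add: rmod_zero_add msum_closed)
next
  case (insert x A)
  then have "msum M f (insert x (A \<union> A')) = madd M (f x) (msum M f (A \<union> A'))"
    using assms(1,3) by (intro msum_insert) auto
  with insert show ?case
    using assms(1,3) by (simp add: msum_insert rmod_assoc msum_closed)
qed

lemma msum_mono_neutral:
  assumes "is_rmod M" "finite A'" "A \<subseteq> A'" "\<And>i. i \<in> A \<Longrightarrow> f i \<in> carr M"
    and "\<And>i. i \<in> A' - A \<Longrightarrow> f i = mzero M"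
  shows "msum M f A' = msum M f A"
proof -
  have "msum M f (A \<union> (A' - A)) = madd M (msum M f A) (msum M f (A' - A))"
  proof (intro msum_union)
    show "f i \<in> carr M" if "i \<in> A \<union> (A' - A)" for i
      using assms that by (cases "i \<in> A") (auto simp: rmod_closed)
  qed (use assms in \<open>auto intro: finite_subset\<close>)
  also have "msum M f (A' - A) = mzero M"
    using assms by (intro msum_all_zero) auto
  finally show ?thesis
    using assms by (simp add: rmod_add_zero msum_closed Un_absorb1)
qed

lemma msum_single:
  assumes "is_rmod M" "finite A" "x \<in> A" "f x \<in> carr M" "\<And>i. i \<in> A - {x} \<Longrightarrow> f i = mzero M"
  shows "msum M f A = f x"
  using msum_mono_neutral[OF assms(1,2), of "{x}" f] msum_insert[of M "{}" x f] assms
  by (simp add: rmod_add_zero)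

lemma msum_reindex:
  assumes "is_rmod M" "inj_on h A" "\<And>i. i \<in> A \<Longrightarrow> f (h i) \<in> carr M"
  shows "msum M f (h ` A) = msum M (\<lambda>i. f (h i)) A"
proof (cases "finite A")
  case True
  then show ?thesis
    using assms(2,3)
  proof (induction A rule: finite_induct)
    case (insert x A)
    then have "msum M f (insert (h x) (h ` A)) = madd M (f (h x)) (msum M f (h ` A))"
      using assms(1) by (intro msum_insert) auto
    with insert show ?case
      by (simp add: assms(1) msum_insert)
  qed simp
next
  case False
  then show ?thesis
    using assms(2) by (simp add: msum_def finite_image_iff)
qed

lemma msum_hom:
  assumes "is_rmod M" "is_rmod N" "rlinear M N h" "finite A" "\<And>i. i \<in> A \<Longrightarrow> f i \<in> carr M"
  shows "h (msum M f A) = msum N (\<lambda>i. h (f i)) A"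
  using assms(4,5)
  by (induction A rule: finite_induct)
    (simp_all add: assms(1-3) rlinear_zero msum_insert rlinear_closed[OF assms(3)]
      rlinear_add[OF assms(3)] msum_closed)

lemma msum_add:
  assumes "is_rmod M" "finite A" "\<And>i. i \<in> A \<Longrightarrow> f i \<in> carr M" "\<And>i. i \<in> A \<Longrightarrow> g i \<in> carr M"
  shows "msum M (\<lambda>i. madd M (f i) (g i)) A = madd M (msum M f A) (msum M g A)"
  using assms(2-)
  by (induction A rule: finite_induct)
    (simp_all add: assms(1) rmod_zero_add msum_insert rmod_closed msum_closed rmod_assoc rmod_lcomm)

lemma rlinear_msmul: "is_rmod M \<Longrightarrow> rlinear M M (msmul M r)"
  by (simp add: rlinear_def rmod_closed rmod_smul_add rmod_smul_smul mult.commute)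

lemma msum_smul:
  assumes "is_rmod M" "finite A" "\<And>i. i \<in> A \<Longrightarrow> f i \<in> carr M"
  shows "msum M (\<lambda>i. msmul M r (f i)) A = msmul M r (msum M f A)"
  using msum_hom[OF assms(1,1) rlinear_msmul[OF assms(1)] assms(2,3)] by simp

lemma msum_rsubmod:
  assumes "is_rmod M" "rsubmod M S" "finite A" "\<And>i. i \<in> A \<Longrightarrow> f i \<in> S"
  shows "msum M f A \<in> S"
  using assms(3,4)
  by (induction A rule: finite_induct)
    (simp_all add: assms(1) msum_insert rsubmod_zero[OF assms(2)] rsubmod_add[OF assms(2)]
      rsubmod_subset[OF assms(2)])

subsection \<open>Signs\<close>

definition psign :: "nat \<Rightarrow> nat set \<Rightarrow> 'r::comm_ring_1" where
  "psign i I = (- 1) ^ card {j \<in> insert i I. j \<le> i}"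

text \<open>Positions are counted from one, whence the leading minus. In particular the least index
  has sign -1, which fixes the signs in the contracting homotopy and in degree zero.\<close>

lemma psign_alt:
  assumes "finite I" "i \<notin> I"
  shows "psign i I = - ((- 1) ^ card {j \<in> I. j < i})"
proof -
  have "{j \<in> insert i I. j \<le> i} = insert i {j \<in> I. j < i}"
    using assms by (auto simp: le_less)
  then show ?thesis
    using assms by (simp add: psign_def)
qed

lemma psign_insert:
  assumes "finite I" "i \<notin> I" "j \<notin> I" "i \<noteq> j"
  shows "psign j (insert i I) = (if i < j then - psign j I else psign j I :: 'r::comm_ring_1)"
proof -
  have "{k \<in> insert i I. k < j} = (if i < j then insert i {k \<in> I. k < j} else {k \<in> I. k < j})"
    by auto
  then show ?thesis
    using assms by (simp add: psign_alt)
qed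

text \<open>This is the sign identity behind naturality of the differential. The inversions
  involving i are p (left of i, moved to the right) and q (right of i, moved to the left), while r
  stays on the left. The position of i counts p and r, that of \<alpha> i counts q and r. So the
  exponents on the two sides differ by twice the size of q.\<close>

lemma wsign_insert:
  assumes I: "finite I" "i \<notin> I" and \<alpha>: "inj_on \<alpha> (insert i I)"
  shows "psign (\<alpha> i) (\<alpha> ` I) * wsign \<alpha> (insert i I) = wsign \<alpha> I * (psign i I :: 'r::comm_ring_1)"
proof -
  define N where "N = {(i, j). i \<in> I \<and> j \<in> I \<and> i < j \<and> \<alpha> j < \<alpha> i}"
  define p where "p = {j \<in> I. j < i \<and> \<alpha> i < \<alpha> j}"
  define q where "q = {j \<in> I. i < j \<and> \<alpha> j < \<alpha> i}"
  define r where "r = {j \<in> I. j < i \<and> \<alpha> j < \<alpha> i}"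
  have ne: "\<alpha> j \<noteq> \<alpha> i" if "j \<in> I" for j
    using \<alpha> I that by (auto simp: inj_on_def)
  have fin: "finite N" "finite p" "finite q" "finite r"
    using I by (auto simp: N_def p_def q_def r_def intro: finite_subset[of _ "I \<times> I"])
  have "{(j, k). j \<in> insert i I \<and> k \<in> insert i I \<and> j < k \<and> \<alpha> k < \<alpha> j}
      = N \<union> (\<lambda>j. (j, i)) ` p \<union> Pair i ` q"
    by (auto simp: N_def p_def q_def)
  also have "card \<dots> = card N + card p + card q"
    using fin I by (subst card_Un_disjoint, auto simp: N_def p_def q_def)
      (subst card_Un_disjoint, auto simp: card_image inj_on_def)
  finally have 1: "card {(j, k). j \<in> insert i I \<and> k \<in> insert i I \<and> j < k \<and> \<alpha> k < \<alpha> j}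
      = card N + card p + card q" .
  then have w: "wsign \<alpha> (insert i I) = (- 1 :: 'r) ^ (card N + card p + card q)"
    by (simp only: wsign_def)
  have "{j \<in> I. j < i} = p \<union> r"
    using ne by (auto simp: p_def r_def neq_iff)
  then have 2: "card {j \<in> I. j < i} = card p + card r"
    using fin by (simp add: card_Un_disjoint p_def r_def disjoint_iff)
  have "{k \<in> \<alpha> ` I. k < \<alpha> i} = \<alpha> ` (q \<union> r)"
    using I by (auto simp: q_def r_def) (metis (lifting) UnI1 UnI2 imageI mem_Collect_eq neqE)
  moreover have "card (\<alpha> ` (q \<union> r)) = card (q \<union> r)"
    using \<alpha> by (intro card_image) (auto simp: inj_on_def q_def r_def)
  ultimately have 3: "card {k \<in> \<alpha> ` I. k < \<alpha> i} = card q + card r"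
    using fin by (simp add: card_Un_disjoint q_def r_def disjoint_iff)
  have "\<alpha> i \<notin> \<alpha> ` I"
    using ne by force
  moreover have "(- 1 :: 'r) ^ (card q + card q) = 1"
    by (simp flip: mult_2)
  ultimately show ?thesis
    unfolding w wsign_def[of \<alpha> I] N_def[symmetric]
    using I by (simp add: psign_alt 2 3 power_add mult_ac)
qed

text \<open>Removing two elements \<open>i\<close> and \<open>j\<close> in the two possible orders gives opposite signs.\<close>
lemma psign_sum_sum_eq_zero:
  fixes F :: "nat set \<Rightarrow> 'r::comm_ring_1"
  assumes X: "finite X" and I: "I \<subseteq> X"
  shows "(\<Sum>i\<in>X - I. psign i I * (\<Sum>j\<in>X - insert i I. psign j (insert i I) * F (insert j (insert i I)))) = 0"
proof -
  define W where "W = X - I"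
  define G where "G i j = psign i I * (psign j (insert i I) * F (insert j (insert i I)))" for i j
  define lower where "lower = {(i, j). i \<in> W \<and> j \<in> W \<and> i < j}"
  define upper where "upper = {(i, j). i \<in> W \<and> j \<in> W \<and> j < i}"
  have fin: "finite W" "finite I" "finite lower" "finite upper"
    using X I by (auto simp: W_def lower_def upper_def intro: finite_subset finite_subset[of _ "X \<times> X"])
  have "(\<Sum>i\<in>X - I. psign i I * (\<Sum>j\<in>X - insert i I. psign j (insert i I) * F (insert j (insert i I))))
      = (\<Sum>i\<in>W. \<Sum>j\<in>W - {i}. G i j)"
    unfolding W_def G_def sum_distrib_left
    by (intro sum.cong refl) auto
  also have "\<dots> = (\<Sum>(i, j)\<in>Sigma W (\<lambda>i. W - {i}). G i j)"
    using fin by (intro sum.Sigma) auto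
  also have "Sigma W (\<lambda>i. W - {i}) = lower \<union> upper"
    by (auto simp: lower_def upper_def)
  also have "(\<Sum>(i, j)\<in>lower \<union> upper. G i j) = (\<Sum>(i, j)\<in>lower. G i j) + (\<Sum>(i, j)\<in>upper. G i j)"
    using fin by (intro sum.union_disjoint) (auto simp: lower_def upper_def)
  also have "(\<Sum>(i, j)\<in>upper. G i j) = (\<Sum>(i, j)\<in>lower. G j i)"
    by (rule sum.reindex_bij_witness[where i = prod.swap and j = prod.swap])
      (auto simp: lower_def upper_def)
  \<comment> \<open>For i < j, having i inserted first flips the sign of j, while having j inserted
    first leaves the sign of i alone.\<close>
  also have "\<dots> = (\<Sum>(i, j)\<in>lower. - G i j)"
    using fin by (intro sum.cong refl)
      (auto simp: lower_def G_def W_def psign_insert insert_commute mult_ac)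
  finally show ?thesis
    by (simp add: case_prod_unfold sum_negf)
qed

subsection \<open>The complex of an FI-module\<close>

lemma Stilde_simps [simp]: "fobj (Stilde V a) = Stilde_obj V a" "fmor (Stilde V a) = Stilde_mor V a"
  by (simp_all add: Stilde_def)

lemma Stilde_obj_carr: "c \<in> carr (Stilde_obj V a X) \<longleftrightarrow>
    (\<forall>I. I \<subseteq> X \<and> card I = a \<longrightarrow> c I \<in> carr (fobj V (X - I))) \<and>
    (\<forall>I. \<not> (I \<subseteq> X \<and> card I = a) \<longrightarrow> c I = undefined)"
  by (simp add: Stilde_obj_def)

lemma Stilde_obj_closed: "c \<in> carr (Stilde_obj V a X) \<Longrightarrow> I \<subseteq> X \<Longrightarrow> card I = a \<Longrightarrow>
    c I \<in> carr (fobj V (X - I))"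
  by (simp add: Stilde_obj_def)

lemma Stilde_obj_apply:
  assumes "I \<subseteq> X" "card I = a"
  shows "madd (Stilde_obj V a X) c c' I = madd (fobj V (X - I)) (c I) (c' I)"
    and "mzero (Stilde_obj V a X) I = mzero (fobj V (X - I))"
    and "msmul (Stilde_obj V a X) r c I = msmul (fobj V (X - I)) r (c I)"
  using assms by (simp_all add: Stilde_obj_def)

lemma Stilde_obj_undefined:
  assumes "\<not> (I \<subseteq> X \<and> card I = a)"
  shows "madd (Stilde_obj V a X) c c' I = undefined"
    and "mzero (Stilde_obj V a X) I = undefined"
    and "msmul (Stilde_obj V a X) r c I = undefined"
  using assms by (auto simp: Stilde_obj_def)

lemma Stilde_obj_eqI:
  assumes "\<And>I. I \<subseteq> X \<Longrightarrow> card I = a \<Longrightarrow> c I = c' I"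
    and "\<And>I. \<not> (I \<subseteq> X \<and> card I = a) \<Longrightarrow> c I = undefined"
    and "\<And>I. \<not> (I \<subseteq> X \<and> card I = a) \<Longrightarrow> c' I = undefined"
  shows "c = c'"
  using assms by (metis ext)

lemma is_rmod_Stilde_obj:
  assumes V: "fi_premodule V" and X: "finite X"
  shows "is_rmod (Stilde_obj V a X)"
proof -
  have M: "is_rmod (fobj V (X - I))" for I
    using fi_premodule_rmod[OF V] X by simp
  let ?M = "Stilde_obj V a X"
  have inv: "\<exists>y\<in>carr ?M. madd ?M x y = mzero ?M" if "x \<in> carr ?M" for x
    using that M rmod_sub_self[OF M]
    by (intro bexI[of _ "msmul ?M (- 1) x"])
      (auto simp: Stilde_obj_def rmod_closed fun_eq_iff)
  show ?thesis
    unfolding is_rmod_def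
  proof (intro conjI ballI allI)
    show "\<exists>y\<in>carr ?M. madd ?M x y = mzero ?M" if "x \<in> carr ?M" for x
      by (rule inv[OF that])
  qed (auto simp: Stilde_obj_def fun_eq_iff M rmod_closed rmod_assoc rmod_zero_add rmod_smul_smul
      rmod_add_smul rmod_smul_add rmod_one_smul intro: rmod_comm)
qed

lemma fi_inj_diff:
  assumes "fi_inj X Y \<alpha>" "I \<subseteq> X"
  shows "fi_inj (X - I) (Y - \<alpha> ` I) \<alpha>"
  using assms unfolding fi_inj_def by (auto simp: inj_on_def)

lemma fi_inj_image:
  assumes "fi_inj X Y \<alpha>" "I \<subseteq> X"
  shows "\<alpha> ` I \<subseteq> Y" "card (\<alpha> ` I) = card I" "inv_into X \<alpha> ` \<alpha> ` I = I"
  using assms unfolding fi_inj_def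
  by (auto intro!: card_image intro: inj_on_subset simp: inv_into_image_cancel)

lemma fi_inj_id: "finite Y \<Longrightarrow> X \<subseteq> Y \<Longrightarrow> fi_inj X Y id"
  by (auto simp: fi_inj_def finite_subset)

lemma Stilde_mor_image:
  assumes "fi_inj X Y \<alpha>" "I \<subseteq> X" "card I = a"
  shows "Stilde_mor V a X Y \<alpha> c (\<alpha> ` I) =
    msmul (fobj V (Y - \<alpha> ` I)) (wsign \<alpha> I) (fmor V (X - I) (Y - \<alpha> ` I) \<alpha> (c I))"
  using fi_inj_image[OF assms(1,2)] assms by (simp add: Stilde_mor_def image_mono)

lemma Stilde_mor_zero:
  assumes "J \<subseteq> Y" "card J = a" "\<not> J \<subseteq> \<alpha> ` X"
  shows "Stilde_mor V a X Y \<alpha> c J = mzero (fobj V (Y - J))"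
  using assms by (simp add: Stilde_mor_def)

lemma Stilde_mor_undefined:
  assumes "\<not> (J \<subseteq> Y \<and> card J = a)"
  shows "Stilde_mor V a X Y \<alpha> c J = undefined"
  using assms by (auto simp: Stilde_mor_def)

text \<open>The cases follow the clauses of \<open>Stilde_mor\<close>. Naming the preimage I in the
  last one removes \<open>inv_into\<close> from all later arguments.\<close>

lemma image_index_cases:
  assumes "fi_inj X Y \<alpha>"
  obtains "\<not> (J \<subseteq> Y \<and> card J = a)" | "J \<subseteq> Y" "card J = a" "\<not> J \<subseteq> \<alpha> ` X"
    | I where "J = \<alpha> ` I" "I \<subseteq> X" "card I = a" "J \<subseteq> Y" "card J = a"
  using fi_inj_image[OF assms] by (metis subset_imageE)

lemma rlinear_Stilde_mor:
  assumes V: "fi_premodule V" and \<alpha>: "fi_inj X Y \<alpha>"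
  shows "rlinear (Stilde_obj V a X) (Stilde_obj V a Y) (Stilde_mor V a X Y \<alpha>)"
proof -
  have XY: "finite X" "finite Y"
    using fi_inj_finite[OF \<alpha>] by auto
  note M = fi_premodule_rmod[OF V finite_Diff[OF XY(1)]] fi_premodule_rmod[OF V finite_Diff[OF XY(2)]]
  note lin = fi_premodule_mor[OF V fi_inj_diff[OF \<alpha>]]
  note und = Stilde_mor_undefined Stilde_obj_undefined
  show ?thesis
    unfolding rlinear_def
  proof (intro conjI ballI allI)
    fix x
    assume x: "x \<in> carr (Stilde_obj V a X)"
    have "Stilde_mor V a X Y \<alpha> x J \<in> carr (fobj V (Y - J))" if "J \<subseteq> Y" "card J = a" for J
      using \<alpha>
    proof (cases rule: image_index_cases[of X Y \<alpha> J a])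
      case (3 I)
      then show ?thesis
        using rlinear_closed[OF lin[OF 3(2)] Stilde_obj_closed[OF x 3(2,3)]] M
        by (simp add: Stilde_mor_image[OF \<alpha>] rmod_closed)
    qed (use that M in \<open>auto simp: Stilde_mor_zero rmod_closed\<close>)
    then show "Stilde_mor V a X Y \<alpha> x \<in> carr (Stilde_obj V a Y)"
      by (simp add: Stilde_obj_carr Stilde_mor_undefined)
    show "Stilde_mor V a X Y \<alpha> (msmul (Stilde_obj V a X) r x) =
        msmul (Stilde_obj V a Y) r (Stilde_mor V a X Y \<alpha> x)" for r
    proof
      fix J
      show "Stilde_mor V a X Y \<alpha> (msmul (Stilde_obj V a X) r x) J =
        msmul (Stilde_obj V a Y) r (Stilde_mor V a X Y \<alpha> x) J"
        using \<alpha>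
      proof (cases rule: image_index_cases[of X Y \<alpha> J a])
        case 1
        then show ?thesis
          by (simp only: und[OF 1])
      next
        case 2
        then show ?thesis
          by (simp add: Stilde_mor_zero Stilde_obj_apply rmod_smul_zero M)
      next
        case (3 I)
        then show ?thesis
          using Stilde_obj_closed[OF x 3(2,3)] lin[OF 3(2)]
          by (simp add: Stilde_mor_image[OF \<alpha>] Stilde_obj_apply rlinear_smul
              rmod_smul_smul M rlinear_closed mult.commute)
      qed
    qed
    fix y
    assume y: "y \<in> carr (Stilde_obj V a X)"
    show "Stilde_mor V a X Y \<alpha> (madd (Stilde_obj V a X) x y) =
        madd (Stilde_obj V a Y) (Stilde_mor V a X Y \<alpha> x) (Stilde_mor V a X Y \<alpha> y)"
    proof
      fix J
      show "Stilde_mor V a X Y \<alpha> (madd (Stilde_obj V a X) x y) J =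
        madd (Stilde_obj V a Y) (Stilde_mor V a X Y \<alpha> x) (Stilde_mor V a X Y \<alpha> y) J"
        using \<alpha>
      proof (cases rule: image_index_cases[of X Y \<alpha> J a])
        case 1
        then show ?thesis
          by (simp only: und[OF 1])
      next
        case 2
        then show ?thesis
          by (simp add: Stilde_mor_zero Stilde_obj_apply rmod_zero_add rmod_closed M)
      next
        case (3 I)
        then show ?thesis
          using Stilde_obj_closed[OF x 3(2,3)] Stilde_obj_closed[OF y 3(2,3)] lin[OF 3(2)]
          by (simp add: Stilde_mor_image[OF \<alpha>] Stilde_obj_apply rlinear_add
              rmod_smul_add M rlinear_closed)
      qed
    qed
  qed
qed

lemma fi_premodule_Stilde: "fi_premodule V \<Longrightarrow> fi_premodule (Stilde V a)"
  by (simp add: fi_premodule_def[of "Stilde V a"] is_rmod_Stilde_obj rlinear_Stilde_mor)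

text \<open>The differential is organised by its target index: I is a face of exactly the sets
  insert i I with i outside I, so the coefficient at I is a sum over X - I.\<close>

definition dterm :: "('r::comm_ring_1, 'v) fimod \<Rightarrow> nat set \<Rightarrow> (nat set \<Rightarrow> 'v) \<Rightarrow> nat set \<Rightarrow> nat \<Rightarrow> 'v" where
  "dterm V X c I i = msmul (fobj V (X - I)) (psign i I)
     (fmor V (X - insert i I) (X - I) id (c (insert i I)))"

lemma dStilde_apply: "I \<subseteq> X \<Longrightarrow> card I = a \<Longrightarrow>
    dStilde V a X c I = msum (fobj V (X - I)) (dterm V X c I) (X - I)"
  by (simp add: dStilde_def dterm_def[abs_def] psign_def)

lemma dStilde_undefined:
  assumes "\<not> (I \<subseteq> X \<and> card I = a)"
  shows "dStilde V a X c I = undefined"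
  using assms by (auto simp: dStilde_def)

lemma index_insert:
  assumes "finite X" "I \<subseteq> X" "card I = a" "i \<in> X - I"
  shows "insert i I \<subseteq> X" "card (insert i I) = Suc a" "fi_inj (X - insert i I) (X - I) id"
  using assms finite_subset[OF assms(2,1)] by (auto intro: fi_inj_id)

lemma Stilde_incl_closed:
  assumes V: "fi_premodule V" and X: "finite X" and c: "c \<in> carr (Stilde_obj V (Suc a) X)"
    and I: "I \<subseteq> X" "card I = a" "i \<in> X - I"
  shows "fmor V (X - insert i I) (X - I) id (c (insert i I)) \<in> carr (fobj V (X - I))"
  using index_insert[OF X I] Stilde_obj_closed[OF c] rlinear_closed[OF fi_premodule_mor[OF V]] by metis

lemma dterm_closed:
  assumes V: "fi_premodule V" and X: "finite X" and c: "c \<in> carr (Stilde_obj V (Suc a) X)"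
    and I: "I \<subseteq> X" "card I = a" "i \<in> X - I"
  shows "dterm V X c I i \<in> carr (fobj V (X - I))"
  using Stilde_incl_closed[OF assms] fi_premodule_rmod[OF V finite_Diff[OF X]]
  by (simp add: dterm_def rmod_closed)

lemma rlinear_dStilde:
  assumes V: "fi_premodule V" and X: "finite X"
  shows "rlinear (Stilde_obj V (Suc a) X) (Stilde_obj V a X) (dStilde V a X)"
proof -
  note M = fi_premodule_rmod[OF V finite_Diff[OF X]]
  show ?thesis
    unfolding rlinear_def
  proof (intro conjI ballI allI)
    fix x
    assume x: "x \<in> carr (Stilde_obj V (Suc a) X)"
    show "dStilde V a X x \<in> carr (Stilde_obj V a X)"
      using dterm_closed[OF V X x] by (auto simp: Stilde_obj_carr dStilde_undefined dStilde_apply M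
          intro!: msum_closed)
    show "dStilde V a X (msmul (Stilde_obj V (Suc a) X) r x) = msmul (Stilde_obj V a X) r (dStilde V a X x)" for r
    proof (rule Stilde_obj_eqI[of X a])
      fix I
      assume I: "I \<subseteq> X" "card I = a"
      have "dterm V X (msmul (Stilde_obj V (Suc a) X) r x) I i = msmul (fobj V (X - I)) r (dterm V X x I i)"
        if i: "i \<in> X - I" for i
        unfolding dterm_def Stilde_obj_apply(3)[OF index_insert(1,2)[OF X I i]]
          rlinear_smul[OF fi_premodule_mor[OF V index_insert(3)[OF X I i]]
            Stilde_obj_closed[OF x index_insert(1,2)[OF X I i]]]
        using Stilde_incl_closed[OF V X x I i] by (simp add: rmod_smul_smul M mult.commute)
      then have "dStilde V a X (msmul (Stilde_obj V (Suc a) X) r x) I =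
          msum (fobj V (X - I)) (\<lambda>i. msmul (fobj V (X - I)) r (dterm V X x I i)) (X - I)"
        unfolding dStilde_apply[OF I] using dterm_closed[OF V X x I]
        by (intro msum_cong) (simp_all add: M rmod_closed)
      also have "\<dots> = msmul (Stilde_obj V a X) r (dStilde V a X x) I"
        unfolding Stilde_obj_apply[OF I] dStilde_apply[OF I]
        using X dterm_closed[OF V X x I] by (intro msum_smul) (simp_all add: M)
      finally show "dStilde V a X (msmul (Stilde_obj V (Suc a) X) r x) I =
          msmul (Stilde_obj V a X) r (dStilde V a X x) I" .
    qed (simp_all only: dStilde_undefined Stilde_obj_undefined not_False_eq_True)
    fix y
    assume y: "y \<in> carr (Stilde_obj V (Suc a) X)"
    show "dStilde V a X (madd (Stilde_obj V (Suc a) X) x y) =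
        madd (Stilde_obj V a X) (dStilde V a X x) (dStilde V a X y)"
    proof (rule Stilde_obj_eqI[of X a])
      fix I
      assume I: "I \<subseteq> X" "card I = a"
      have "dterm V X (madd (Stilde_obj V (Suc a) X) x y) I i =
          madd (fobj V (X - I)) (dterm V X x I i) (dterm V X y I i)"
        if i: "i \<in> X - I" for i
        unfolding dterm_def Stilde_obj_apply(1)[OF index_insert(1,2)[OF X I i]]
          rlinear_add[OF fi_premodule_mor[OF V index_insert(3)[OF X I i]]
            Stilde_obj_closed[OF x index_insert(1,2)[OF X I i]]
            Stilde_obj_closed[OF y index_insert(1,2)[OF X I i]]]
        using Stilde_incl_closed[OF V X x I i] Stilde_incl_closed[OF V X y I i]
        by (simp add: rmod_smul_add M)
      then have "dStilde V a X (madd (Stilde_obj V (Suc a) X) x y) I =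
          msum (fobj V (X - I)) (\<lambda>i. madd (fobj V (X - I)) (dterm V X x I i) (dterm V X y I i)) (X - I)"
        unfolding dStilde_apply[OF I] using dterm_closed[OF V X x I] dterm_closed[OF V X y I]
        by (intro msum_cong) (simp_all add: M rmod_closed)
      also have "\<dots> = madd (Stilde_obj V a X) (dStilde V a X x) (dStilde V a X y) I"
        unfolding Stilde_obj_apply[OF I] dStilde_apply[OF I]
        using X dterm_closed[OF V X x I] dterm_closed[OF V X y I] by (intro msum_add) (simp_all add: M)
      finally show "dStilde V a X (madd (Stilde_obj V (Suc a) X) x y) I =
          madd (Stilde_obj V a X) (dStilde V a X x) (dStilde V a X y) I" .
    qed (simp_all only: dStilde_undefined Stilde_obj_undefined not_False_eq_True)
  qed
qed

lemma fimod_comp: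
  assumes "is_fimod V" "fi_inj X Y \<alpha>" "fi_inj Y Z \<beta>" "v \<in> carr (fobj V X)"
  shows "fmor V Y Z \<beta> (fmor V X Y \<alpha> v) = fmor V X Z (\<beta> \<circ> \<alpha>) v"
  using assms unfolding is_fimod_def by simp

text \<open>If J is not inside the image of \<alpha>, neither is any insert j J, and both sides
  vanish at J. If J = \<alpha>(I), only the indices j = \<alpha> i with i in X - I contribute; the
  sum is pulled back along \<alpha>, the signs match by \<open>wsign_insert\<close>, and
  functoriality identifies the two routes from X - insert i I to Y - J.\<close>

lemma dStilde_natural:
  assumes V: "is_fimod V" and \<alpha>: "fi_inj X Y \<alpha>" and c: "c \<in> carr (Stilde_obj V (Suc a) X)"
  shows "dStilde V a Y (Stilde_mor V (Suc a) X Y \<alpha> c) = Stilde_mor V a X Y \<alpha> (dStilde V a X c)"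
proof
  fix J
  note V' = is_fimod_premodule[OF V]
  have XY: "finite X" "finite Y" and inj: "inj_on \<alpha> X" and im: "\<alpha> ` X \<subseteq> Y"
    using \<alpha> by (auto simp: fi_inj_def)
  note MX = fi_premodule_rmod[OF V' finite_Diff[OF XY(1)]]
  note MY = fi_premodule_rmod[OF V' finite_Diff[OF XY(2)]]
  have outside: "dterm V Y (Stilde_mor V (Suc a) X Y \<alpha> c) J j = mzero (fobj V (Y - J))"
    if J: "J \<subseteq> Y" "card J = a" and j: "j \<in> Y - J" and n: "\<not> insert j J \<subseteq> \<alpha> ` X" for j J
    unfolding dterm_def Stilde_mor_zero[OF index_insert(1,2)[OF XY(2) J j] n]
    using rlinear_zero[OF MY MY fi_premodule_mor[OF V' index_insert(3)[OF XY(2) J j]]]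
    by (simp add: rmod_smul_zero MY)
  show "dStilde V a Y (Stilde_mor V (Suc a) X Y \<alpha> c) J = Stilde_mor V a X Y \<alpha> (dStilde V a X c) J"
    using \<alpha>
  proof (cases rule: image_index_cases[of X Y \<alpha> J a])
    case 1
    then show ?thesis
      by (simp only: dStilde_undefined[OF 1] Stilde_mor_undefined[OF 1])
  next
    case 2
    then have "msum (fobj V (Y - J)) (dterm V Y (Stilde_mor V (Suc a) X Y \<alpha> c) J) (Y - J) =
        mzero (fobj V (Y - J))"
      by (intro msum_all_zero MY outside) auto
    then show ?thesis
      unfolding Stilde_mor_zero[OF 2] using 2 by (simp add: dStilde_apply)
  next
    case (3 I)
    note I = 3(2,3)
    let ?M = "fobj V (Y - J)"
    define g where "g i = fmor V (X - insert i I) (Y - J) \<alpha> (c (insert i I))" for i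
    have incl: "fi_inj (X - I) (Y - J) \<alpha>"
      using fi_inj_diff[OF \<alpha> I(1)] 3(1) by simp
    have inj': "fi_inj (X - insert i I) (Y - J) \<alpha>" if "i \<in> X - I" for i
      using incl by (auto simp: fi_inj_def inj_on_def)
    have g: "g i \<in> carr ?M" if "i \<in> X - I" for i
      unfolding g_def using that index_insert[OF XY(1) I that] inj'
      by (intro rlinear_closed[OF fi_premodule_mor[OF V']] Stilde_obj_closed[OF c]) auto
    have Ifin: "finite I"
      using I XY(1) finite_subset by blast
    have dt: "dterm V Y (Stilde_mor V (Suc a) X Y \<alpha> c) J (\<alpha> i) =
        msmul ?M (wsign \<alpha> I * psign i I) (g i)" if i: "i \<in> X - I" for i
    proof -
      note ii = index_insert[OF XY(1) I i]
      let ?N = "fobj V (Y - insert (\<alpha> i) J)"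
      have J: "insert (\<alpha> i) J = \<alpha> ` insert i I"
        using 3(1) by simp
      have \<alpha>i: "\<alpha> i \<in> Y - J"
        using i inj im I 3(1) by (auto simp: inj_on_def)
      note jj = index_insert[OF XY(2) 3(4,5) \<alpha>i]
      have \<alpha>': "fi_inj (X - insert i I) (Y - insert (\<alpha> i) J) \<alpha>"
        using fi_inj_diff[OF \<alpha> ii(1)] J by simp
      note ci = Stilde_obj_closed[OF c ii(1,2)]
      have "Stilde_mor V (Suc a) X Y \<alpha> c (insert (\<alpha> i) J) =
          msmul ?N (wsign \<alpha> (insert i I)) (fmor V (X - insert i I) (Y - insert (\<alpha> i) J) \<alpha> (c (insert i I)))"
        unfolding J by (rule Stilde_mor_image[OF \<alpha> ii(1,2)])
      then have "dterm V Y (Stilde_mor V (Suc a) X Y \<alpha> c) J (\<alpha> i) =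
        msmul ?M (psign (\<alpha> i) J * wsign \<alpha> (insert i I)) (g i)"
        using rlinear_smul[OF fi_premodule_mor[OF V' jj(3)] rlinear_closed[OF fi_premodule_mor[OF V' \<alpha>'] ci]]
          fimod_comp[OF V \<alpha>' jj(3) ci] g[OF i]
        by (simp add: dterm_def rmod_smul_smul MY g_def)
      moreover have inj': "inj_on \<alpha> (insert i I)"
        using inj I i by (auto simp: inj_on_def)
      have "i \<notin> I"
        using i by simp
      ultimately show ?thesis
        by (simp only: 3(1) wsign_insert[OF Ifin _ inj'] not_False_eq_True)
    qed
    have sub: "\<alpha> ` (X - I) \<subseteq> Y - J"
      using incl by (simp add: fi_inj_def)
    have tc: "msmul ?M (wsign \<alpha> I * psign i I) (g i) \<in> carr ?M" if "i \<in> X - I" for i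
      using g[OF that] by (simp add: rmod_closed MY)
    have "dStilde V a Y (Stilde_mor V (Suc a) X Y \<alpha> c) J =
        msum ?M (dterm V Y (Stilde_mor V (Suc a) X Y \<alpha> c) J) (\<alpha> ` (X - I))"
      unfolding dStilde_apply[OF 3(4,5)]
    proof (rule msum_mono_neutral[OF MY _ sub])
      show "finite (Y - J)"
        using XY by simp
      show "dterm V Y (Stilde_mor V (Suc a) X Y \<alpha> c) J j \<in> carr ?M" if "j \<in> \<alpha> ` (X - I)" for j
        using that tc dt by auto
      show "dterm V Y (Stilde_mor V (Suc a) X Y \<alpha> c) J j = mzero ?M" if "j \<in> Y - J - \<alpha> ` (X - I)" for j
        using that 3(1) by (intro outside 3(4,5)) auto
    qed
    also have "\<dots> = msum ?M (\<lambda>i. dterm V Y (Stilde_mor V (Suc a) X Y \<alpha> c) J (\<alpha> i)) (X - I)"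
      using inj tc dt by (intro msum_reindex MY) (auto intro: inj_on_subset)
    also have "\<dots> = msum ?M (\<lambda>i. msmul ?M (wsign \<alpha> I) (msmul ?M (psign i I) (g i))) (X - I)"
      using tc dt g by (intro msum_cong MY) (auto simp: rmod_smul_smul MY)
    also have "\<dots> = msum ?M (\<lambda>i. msmul ?M (wsign \<alpha> I) (fmor V (X - I) (Y - J) \<alpha> (dterm V X c I i))) (X - I)"
    proof (intro msum_cong MY)
      fix i
      assume i: "i \<in> X - I"
      note ii = index_insert[OF XY(1) I i]
      have "fmor V (X - I) (Y - J) \<alpha> (dterm V X c I i) = msmul ?M (psign i I) (g i)"
        using rlinear_smul[OF fi_premodule_mor[OF V' incl] Stilde_incl_closed[OF V' XY(1) c I i]]
          fimod_comp[OF V ii(3) incl Stilde_obj_closed[OF c ii(1,2)]]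
        by (simp add: dterm_def g_def)
      then show "msmul ?M (wsign \<alpha> I) (msmul ?M (psign i I) (g i)) =
          msmul ?M (wsign \<alpha> I) (fmor V (X - I) (Y - J) \<alpha> (dterm V X c I i))"
        and "msmul ?M (wsign \<alpha> I) (fmor V (X - I) (Y - J) \<alpha> (dterm V X c I i)) \<in> carr ?M"
        using g[OF i] by (simp_all add: rmod_closed MY)
    qed
    also have "\<dots> = msmul ?M (wsign \<alpha> I) (msum ?M (\<lambda>i. fmor V (X - I) (Y - J) \<alpha> (dterm V X c I i)) (X - I))"
      using XY(1) dterm_closed[OF V' XY(1) c I]
      by (intro msum_smul MY) (auto intro: rlinear_closed[OF fi_premodule_mor[OF V' incl]])
    also have "msum ?M (\<lambda>i. fmor V (X - I) (Y - J) \<alpha> (dterm V X c I i)) (X - I) =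
        fmor V (X - I) (Y - J) \<alpha> (dStilde V a X c I)"
      unfolding dStilde_apply[OF I] using XY(1) dterm_closed[OF V' XY(1) c I]
      by (intro msum_hom[symmetric] MX MY fi_premodule_mor[OF V' incl]) auto
    also have "msmul ?M (wsign \<alpha> I) \<dots> = Stilde_mor V a X Y \<alpha> (dStilde V a X c) J"
      unfolding 3(1) by (rule Stilde_mor_image[OF \<alpha> I, symmetric])
    finally show ?thesis .
  qed
qed

lemma fi_hom_dStilde: "is_fimod V \<Longrightarrow> fi_hom (Stilde V (Suc a)) (Stilde V a) (dStilde V a)"
  by (simp add: fi_hom_def rlinear_dStilde is_fimod_premodule dStilde_natural)

section \<open>Functoriality and exactness of the complex in its coefficient module\<close>

definition Smap :: "(nat set \<Rightarrow> 'v \<Rightarrow> 'w) \<Rightarrow> nat \<Rightarrow> nat set \<Rightarrow> (nat set \<Rightarrow> 'v) \<Rightarrow> nat set \<Rightarrow> 'w" where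
  "Smap f a X c = (\<lambda>I. if I \<subseteq> X \<and> card I = a then f (X - I) (c I) else undefined)"

lemma fi_hom_Smap:
  assumes V: "fi_premodule V" and W: "fi_premodule W" and f: "fi_hom V W f"
  shows "fi_hom (Stilde V a) (Stilde W a) (Smap f a)"
  unfolding fi_hom_def Stilde_simps
proof (intro conjI allI impI ballI)
  fix X :: "nat set"
  assume X: "finite X"
  note lin = fi_hom_linear[OF f finite_Diff[OF X]]
  show "rlinear (Stilde_obj V a X) (Stilde_obj W a X) (Smap f a X)"
    unfolding rlinear_def
    by (auto simp: Smap_def Stilde_obj_def fun_eq_iff rlinear_closed[OF lin] rlinear_add[OF lin]
        rlinear_smul[OF lin])
next
  fix X Y \<alpha> c
  assume \<alpha>: "fi_inj X Y \<alpha>" and c: "c \<in> carr (Stilde_obj V a X)"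
  have XY: "finite X" "finite Y"
    using fi_inj_finite[OF \<alpha>] by auto
  show "Smap f a Y (Stilde_mor V a X Y \<alpha> c) = Stilde_mor W a X Y \<alpha> (Smap f a X c)"
  proof
    fix J
    show "Smap f a Y (Stilde_mor V a X Y \<alpha> c) J = Stilde_mor W a X Y \<alpha> (Smap f a X c) J"
      using \<alpha>
    proof (cases rule: image_index_cases[of X Y \<alpha> J a])
      case 1
      then show ?thesis
        by (auto simp: Smap_def Stilde_mor_undefined)
    next
      case 2
      then show ?thesis
        using rlinear_zero[OF _ _ fi_hom_linear[OF f finite_Diff[OF XY(2)]]]
          fi_premodule_rmod[OF V finite_Diff[OF XY(2)]] fi_premodule_rmod[OF W finite_Diff[OF XY(2)]]
        by (simp add: Smap_def Stilde_mor_zero)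
    next
      case (3 I)
      note incl = fi_inj_diff[OF \<alpha> 3(2)]
      note cI = Stilde_obj_closed[OF c 3(2,3)]
      have "Smap f a Y (Stilde_mor V a X Y \<alpha> c) J = f (Y - J) (Stilde_mor V a X Y \<alpha> c J)"
        using 3 by (simp add: Smap_def)
      also have "\<dots> = msmul (fobj W (Y - J)) (wsign \<alpha> I) (fmor W (X - I) (Y - J) \<alpha> (f (X - I) (c I)))"
        unfolding 3(1) Stilde_mor_image[OF \<alpha> 3(2,3)]
        using rlinear_smul[OF fi_hom_linear[OF f finite_Diff[OF XY(2)]]
            rlinear_closed[OF fi_premodule_mor[OF V incl] cI]] fi_hom_natural[OF f incl cI]
        by simp
      also have "\<dots> = Stilde_mor W a X Y \<alpha> (Smap f a X c) J"
        unfolding 3(1) Stilde_mor_image[OF \<alpha> 3(2,3)] using 3 by (simp add: Smap_def)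
      finally show ?thesis .
    qed
  qed
qed

lemma dStilde_Smap:
  assumes V: "fi_premodule V" and W: "fi_premodule W" and f: "fi_hom V W f"
    and X: "finite X" and c: "c \<in> carr (Stilde_obj V (Suc a) X)"
  shows "dStilde W a X (Smap f (Suc a) X c) = Smap f a X (dStilde V a X c)"
proof (rule Stilde_obj_eqI[of X a])
  fix I
  assume I: "I \<subseteq> X" "card I = a"
  note MV = fi_premodule_rmod[OF V finite_Diff[OF X]] and MW = fi_premodule_rmod[OF W finite_Diff[OF X]]
  note lin = fi_hom_linear[OF f finite_Diff[OF X]]
  have "dterm W X (Smap f (Suc a) X c) I i = f (X - I) (dterm V X c I i)" if i: "i \<in> X - I" for i
    using index_insert[OF X I i] rlinear_smul[OF lin Stilde_incl_closed[OF V X c I i]]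
      fi_hom_natural[OF f index_insert(3)[OF X I i] Stilde_obj_closed[OF c index_insert(1,2)[OF X I i]]]
    by (simp add: dterm_def Smap_def)
  then have "dStilde W a X (Smap f (Suc a) X c) I = msum (fobj W (X - I)) (\<lambda>i. f (X - I) (dterm V X c I i)) (X - I)"
    unfolding dStilde_apply[OF I]
    using dterm_closed[OF V X c I] by (intro msum_cong MW) (auto intro: rlinear_closed[OF lin])
  also have "\<dots> = f (X - I) (dStilde V a X c I)"
    unfolding dStilde_apply[OF I] using X dterm_closed[OF V X c I]
    by (intro msum_hom[symmetric] MV MW lin) auto
  finally show "dStilde W a X (Smap f (Suc a) X c) I = Smap f a X (dStilde V a X c) I"
    using I by (simp add: Smap_def)
qed (auto simp: dStilde_undefined Smap_def)

lemma Smap_surj: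
  assumes X: "finite X" and f: "\<And>Y. finite Y \<Longrightarrow> f Y ` carr (fobj V Y) = carr (fobj W Y)"
  shows "Smap f a X ` carr (Stilde_obj V a X) = carr (Stilde_obj W a X)"
proof
  have "f (X - I) v \<in> carr (fobj W (X - I))" if "v \<in> carr (fobj V (X - I))" for I v
    using f[OF finite_Diff[OF X]] that by blast
  then show "Smap f a X ` carr (Stilde_obj V a X) \<subseteq> carr (Stilde_obj W a X)"
    by (auto simp: Stilde_obj_carr Smap_def)
  show "carr (Stilde_obj W a X) \<subseteq> Smap f a X ` carr (Stilde_obj V a X)"
  proof
    fix c
    assume c: "c \<in> carr (Stilde_obj W a X)"
    have "\<exists>v. v \<in> carr (fobj V (X - I)) \<and> f (X - I) v = c I" if "I \<subseteq> X" "card I = a" for I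
      using Stilde_obj_closed[OF c that] f[OF finite_Diff[OF X]] by (metis imageE)
    then obtain h where h: "h I \<in> carr (fobj V (X - I)) \<and> f (X - I) (h I) = c I"
      if "I \<subseteq> X" "card I = a" for I
      by metis
    \<comment> \<open>The carrier prescribes \<open>undefined\<close> off the index set, so the
      chosen preimages have to be cut off there.\<close>
    define b where "b I = (if I \<subseteq> X \<and> card I = a then h I else undefined)" for I
    have "b \<in> carr (Stilde_obj V a X)"
      using h by (auto simp: Stilde_obj_carr b_def)
    moreover have "c = Smap f a X b"
      using h c by (intro Stilde_obj_eqI[of X a]) (auto simp: Smap_def b_def Stilde_obj_carr)
    ultimately show "c \<in> Smap f a X ` carr (Stilde_obj V a X)"
      by blast
  qed
qed

text \<open>Kernels are formed componentwise. With the kernel of g made into an object K by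
  shrinking carriers, exactness becomes surjectivity of f onto K, which is
  \<open>Smap_surj\<close>.\<close>

lemma Smap_exact:
  assumes X: "finite X"
    and exact: "\<And>Y. finite Y \<Longrightarrow> {x \<in> carr (fobj V Y). g Y x = mzero (fobj W Y)} = f Y ` carr (fobj U Y)"
  shows "{x \<in> carr (Stilde_obj V a X). Smap g a X x = mzero (Stilde_obj W a X)}
    = Smap f a X ` carr (Stilde_obj U a X)"
proof -
  define K where "K = \<lparr>fobj = (\<lambda>Y. (fobj V Y)\<lparr>carr := {x \<in> carr (fobj V Y). g Y x = mzero (fobj W Y)}\<rparr>),
    fmor = fmor V\<rparr>"
  have "{x \<in> carr (Stilde_obj V a X). Smap g a X x = mzero (Stilde_obj W a X)} = carr (Stilde_obj K a X)"
    by (auto simp: Stilde_obj_carr Smap_def Stilde_obj_def K_def fun_eq_iff)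
  also have "\<dots> = Smap f a X ` carr (Stilde_obj U a X)"
    using exact by (intro Smap_surj[OF X, symmetric]) (simp add: K_def)
  finally show ?thesis .
qed

subsection \<open>Acyclicity for free FI-modules\<close>

text \<open>The last two assumptions repeat the body of \<open>is_free_fimod\<close> literally, so
  that freeness unfolds to the existence of an instance. Inside the locale the basis can be fixed
  and coordinates can be named.\<close>

locale fi_basis =
  fixes P :: "('r::comm_ring_1, 'p) fimod" and B :: "'p set" and deg :: "'p \<Rightarrow> nat set"
  assumes fimod: "is_fimod P"
    and basis_all: "\<forall>b\<in>B. finite (deg b) \<and> b \<in> carr (fobj P (deg b))"
    and unique_coef: "\<forall>Y. finite Y \<longrightarrow> (\<forall>y\<in>carr (fobj P Y). \<exists>!c :: 'p \<times> (nat \<Rightarrow> nat) \<Rightarrow> 'r.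
        {k. c k \<noteq> 0} \<subseteq> Sigma B (\<lambda>b. fi_homs (deg b) Y) \<and> finite {k. c k \<noteq> 0} \<and>
        y = msum (fobj P Y) (\<lambda>(b, \<alpha>). msmul (fobj P Y) (c (b, \<alpha>)) (fmor P (deg b) Y \<alpha> b))
              {k. c k \<noteq> 0})"
begin

section \<open>Coordinates with respect to the basis\<close>

definition keys :: "nat set \<Rightarrow> ('p \<times> (nat \<Rightarrow> nat)) set" where
  "keys Y = Sigma B (\<lambda>b. fi_homs (deg b) Y)"

definition el :: "nat set \<Rightarrow> 'p \<times> (nat \<Rightarrow> nat) \<Rightarrow> 'p" where
  "el Y k = fmor P (deg (fst k)) Y (snd k) (fst k)"

definition coefs :: "nat set \<Rightarrow> ('p \<times> (nat \<Rightarrow> nat) \<Rightarrow> 'r) set" where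
  "coefs Y = {c. {k. c k \<noteq> 0} \<subseteq> keys Y \<and> finite {k. c k \<noteq> 0}}"

definition comb :: "nat set \<Rightarrow> ('p \<times> (nat \<Rightarrow> nat) \<Rightarrow> 'r) \<Rightarrow> 'p" where
  "comb Y c = msum (fobj P Y) (\<lambda>k. msmul (fobj P Y) (c k) (el Y k)) {k. c k \<noteq> 0}"

definition coef :: "nat set \<Rightarrow> 'p \<Rightarrow> 'p \<times> (nat \<Rightarrow> nat) \<Rightarrow> 'r" where
  "coef Y y = (THE c. c \<in> coefs Y \<and> y = comb Y c)"

abbreviation "PX Y \<equiv> fobj P Y"

lemma basis: "b \<in> B \<Longrightarrow> finite (deg b) \<and> b \<in> carr (PX (deg b))"
  using basis_all by blast

lemmas premod = is_fimod_premodule[OF fimod]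
lemmas rmod = fi_premodule_rmod[OF premod]

lemma ex1_coef: "finite Y \<Longrightarrow> y \<in> carr (PX Y) \<Longrightarrow> \<exists>!c. c \<in> coefs Y \<and> y = comb Y c"
  using unique_coef[THEN spec, of Y]
  by (simp add: coefs_def comb_def el_def keys_def case_prod_unfold conj_assoc)

lemma keys_inj: "finite Y \<Longrightarrow> k \<in> keys Y \<Longrightarrow> fi_inj (deg (fst k)) Y (snd k)"
  using basis by (auto simp: keys_def fi_homs_def fi_inj_def)

lemma el_closed: "finite Y \<Longrightarrow> k \<in> keys Y \<Longrightarrow> el Y k \<in> carr (PX Y)"
  unfolding el_def using basis
  by (intro rlinear_closed[OF fi_premodule_mor[OF premod keys_inj]]) (auto simp: keys_def)

lemma coef_in: "finite Y \<Longrightarrow> y \<in> carr (PX Y) \<Longrightarrow> coef Y y \<in> coefs Y \<and> y = comb Y (coef Y y)"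
  unfolding coef_def by (rule theI'[OF ex1_coef])

text \<open>\<open>comb\<close> sums over the support, which may shrink when coefficient functions
  are added or scaled; a common index set makes such sums comparable.\<close>

lemma comb_superset:
  assumes Y: "finite Y" and A: "finite A" "A \<subseteq> keys Y" "{k. c k \<noteq> 0} \<subseteq> A"
  shows "comb Y c = msum (PX Y) (\<lambda>k. msmul (PX Y) (c k) (el Y k)) A"
  unfolding comb_def using A el_closed[OF Y]
  by (intro msum_mono_neutral[symmetric] rmod Y)
    (auto simp: rmod[OF Y] rmod_closed rmod_zero_smul subset_iff)

lemma comb_closed: "finite Y \<Longrightarrow> c \<in> coefs Y \<Longrightarrow> comb Y c \<in> carr (PX Y)"
  unfolding comb_def coefs_def using el_closed by (auto intro!: msum_closed rmod simp: rmod rmod_closed)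

lemma coef_eqI:
  assumes "finite Y" "c \<in> coefs Y"
  shows "coef Y (comb Y c) = c"
  using ex1_coef[OF assms(1) comb_closed[OF assms]] coef_in[OF assms(1) comb_closed[OF assms]] assms
  by blast

lemma coef_add:
  assumes Y: "finite Y" and x: "x \<in> carr (PX Y)" and y: "y \<in> carr (PX Y)"
  shows "coef Y (madd (PX Y) x y) k = coef Y x k + coef Y y k"
proof -
  let ?c = "coef Y x" and ?c' = "coef Y y"
  let ?A = "{k. ?c k \<noteq> 0} \<union> {k. ?c' k \<noteq> 0}"
  have c: "?c \<in> coefs Y" "x = comb Y ?c" "?c' \<in> coefs Y" "y = comb Y ?c'"
    using coef_in[OF Y] x y by auto
  then have A: "finite ?A" "?A \<subseteq> keys Y"
    by (auto simp: coefs_def)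
  have s: "(\<lambda>k. ?c k + ?c' k) \<in> coefs Y"
    using c(1,3) finite_subset[OF _ A(1), of "{k. ?c k + ?c' k \<noteq> 0}"] A(2)
    by (force simp: coefs_def)
  have "comb Y (\<lambda>k. ?c k + ?c' k) =
      msum (PX Y) (\<lambda>k. msmul (PX Y) (?c k + ?c' k) (el Y k)) ?A"
    using A by (intro comb_superset[OF Y]) auto
  also have "\<dots> = msum (PX Y) (\<lambda>k. madd (PX Y) (msmul (PX Y) (?c k) (el Y k)) (msmul (PX Y) (?c' k) (el Y k))) ?A"
    using A el_closed[OF Y] by (intro msum_cong rmod Y) (auto simp: rmod[OF Y] rmod_add_smul rmod_closed)
  also have "\<dots> = madd (PX Y) (comb Y ?c) (comb Y ?c')"
    using A el_closed[OF Y]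
    by (subst (1 2) comb_superset[OF Y A]) (auto intro!: msum_add simp: rmod[OF Y] rmod_closed)
  finally have "madd (PX Y) x y = comb Y (\<lambda>k. ?c k + ?c' k)"
    using c(2,4) by simp
  then show ?thesis
    using coef_eqI[OF Y s] by simp
qed

lemma coef_smul:
  assumes Y: "finite Y" and x: "x \<in> carr (PX Y)"
  shows "coef Y (msmul (PX Y) r x) k = r * coef Y x k"
proof -
  let ?c = "coef Y x"
  let ?A = "{k. ?c k \<noteq> 0}"
  have c: "?c \<in> coefs Y" "x = comb Y ?c"
    using coef_in[OF Y] x by auto
  then have A: "finite ?A" "?A \<subseteq> keys Y"
    by (auto simp: coefs_def)
  have s: "(\<lambda>k. r * ?c k) \<in> coefs Y"
    using finite_subset[OF _ A(1), of "{k. r * ?c k \<noteq> 0}"] A(2) by (force simp: coefs_def)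
  have "comb Y (\<lambda>k. r * ?c k) = msum (PX Y) (\<lambda>k. msmul (PX Y) (r * ?c k) (el Y k)) ?A"
    using A by (intro comb_superset[OF Y]) auto
  also have "\<dots> = msum (PX Y) (\<lambda>k. msmul (PX Y) r (msmul (PX Y) (?c k) (el Y k))) ?A"
    using A el_closed[OF Y] by (intro msum_cong rmod Y) (auto simp: rmod[OF Y] rmod_smul_smul rmod_closed)
  also have "\<dots> = msmul (PX Y) r (comb Y ?c)"
    unfolding comb_def using A el_closed[OF Y]
    by (intro msum_smul rmod Y) (auto simp: rmod[OF Y] rmod_closed)
  finally have "msmul (PX Y) r x = comb Y (\<lambda>k. r * ?c k)"
    using c(2) by simp
  then show ?thesis
    using coef_eqI[OF Y s] by simp
qed

lemma coef_zero:
  assumes Y: "finite Y"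
  shows "coef Y (mzero (PX Y)) k = 0"
  using coef_smul[OF Y rmod_zero_closed[OF rmod[OF Y]], of 0 k]
  by (simp add: rmod_zero_smul rmod_zero_closed rmod[OF Y])

lemma coef_inj:
  assumes "finite Y" "x \<in> carr (PX Y)" "y \<in> carr (PX Y)" "\<And>k. coef Y x k = coef Y y k"
  shows "x = y"
  using coef_in[OF assms(1)] assms(2-) by (metis ext)

lemma coef_msum:
  assumes Y: "finite Y" and A: "finite A" "\<And>i. i \<in> A \<Longrightarrow> f i \<in> carr (PX Y)"
  shows "coef Y (msum (PX Y) f A) k = (\<Sum>i\<in>A. coef Y (f i) k)"
  using A
proof (induction A rule: finite_induct)
  case empty
  then show ?case
    by (simp add: coef_zero Y)
next
  case (insert x A)
  then show ?case
    by (simp add: msum_insert[OF rmod[OF Y]] coef_add[OF Y] msum_closed[OF rmod[OF Y]])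
qed

lemma keys_mono: "Y \<subseteq> Y' \<Longrightarrow> keys Y \<subseteq> keys Y'"
  by (auto simp: keys_def fi_homs_def)

text \<open>Following \<alpha> with the inclusion gives \<alpha> again, so the basis element with
  key k in P(Y) goes to the one with the same key in P(Y'). This is what decouples the coordinates
  in the complex.\<close>

lemma coef_incl:
  assumes Y: "finite Y'" "Y \<subseteq> Y'" and y: "y \<in> carr (PX Y)"
  shows "coef Y' (fmor P Y Y' id y) = coef Y y"
proof -
  have fY: "finite Y"
    using Y finite_subset by blast
  note incl = fi_inj_id[OF Y]
  let ?c = "coef Y y"
  have c: "?c \<in> coefs Y" "y = comb Y ?c"
    using coef_in[OF fY] y by auto
  then have c': "?c \<in> coefs Y'"
    using keys_mono[OF Y(2)] by (auto simp: coefs_def)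
  have el: "fmor P Y Y' id (el Y k) = el Y' k" if "k \<in> keys Y" for k
    unfolding el_def using that basis
    by (subst fimod_comp[OF fimod keys_inj[OF fY that] incl]) (auto simp: keys_def)
  have "fmor P Y Y' id (comb Y ?c) =
      msum (PX Y') (\<lambda>k. fmor P Y Y' id (msmul (PX Y) (?c k) (el Y k))) {k. ?c k \<noteq> 0}"
    unfolding comb_def using c(1) el_closed[OF fY]
    by (intro msum_hom rmod fY Y fi_premodule_mor[OF premod incl])
      (auto simp: coefs_def rmod[OF fY] rmod_closed)
  also have "\<dots> = comb Y' ?c"
    unfolding comb_def using c(1) el_closed[OF fY] el_closed[OF Y(1)] keys_mono[OF Y(2)] el
    by (intro msum_cong rmod Y)
      (auto simp: coefs_def rlinear_smul[OF fi_premodule_mor[OF premod incl]] rmod[OF Y(1)]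
        intro!: rmod_closed)
  finally show ?thesis
    using coef_eqI[OF Y(1) c'] c(2) by simp
qed

lemma coef_support: "finite Y \<Longrightarrow> y \<in> carr (PX Y) \<Longrightarrow> k \<notin> keys Y \<Longrightarrow> coef Y y k = 0"
  using coef_in unfolding coefs_def by blast

text \<open>Since inclusions preserve coordinates, the differential acts on each key separately, by
  a boundary formula with scalar coefficients.\<close>

lemma coef_dStilde:
  assumes X: "finite X" and c: "c \<in> carr (Stilde_obj P (Suc a) X)" and I: "I \<subseteq> X" "card I = a"
  shows "coef (X - I) (dStilde P a X c I) k =
    (\<Sum>i\<in>X - I. psign i I * coef (X - insert i I) (c (insert i I)) k)"
proof -
  have XI: "finite (X - I)"
    using X by simp
  have "coef (X - I) (dStilde P a X c I) k = (\<Sum>i\<in>X - I. coef (X - I) (dterm P X c I i) k)"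
    unfolding dStilde_apply[OF I] by (intro coef_msum XI dterm_closed[OF premod X c I])
  also have "\<dots> = (\<Sum>i\<in>X - I. psign i I * coef (X - insert i I) (c (insert i I)) k)"
  proof (intro sum.cong refl)
    fix i
    assume i: "i \<in> X - I"
    show "coef (X - I) (dterm P X c I i) k = psign i I * coef (X - insert i I) (c (insert i I)) k"
      unfolding dterm_def coef_smul[OF XI Stilde_incl_closed[OF premod X c I i]]
      using coef_incl[OF XI _ Stilde_obj_closed[OF c index_insert(1,2)[OF X I i]]]
      by (simp add: Diff_mono subset_insertI)
  qed
  finally show ?thesis .
qed

lemma Stilde_obj_coef_eqI:
  assumes X: "finite X" and c: "c \<in> carr (Stilde_obj P a X)" and c': "c' \<in> carr (Stilde_obj P a X)"
    and "\<And>I k. I \<subseteq> X \<Longrightarrow> card I = a \<Longrightarrow> coef (X - I) (c I) k = coef (X - I) (c' I) k"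
  shows "c = c'"
proof (rule Stilde_obj_eqI[of X a])
  show "c I = c' I" if "I \<subseteq> X" "card I = a" for I
    using Stilde_obj_closed[OF c that] Stilde_obj_closed[OF c' that] assms(4)[OF that] X
    by (intro coef_inj[of "X - I"]) auto
qed (use c c' in \<open>auto simp: Stilde_obj_carr\<close>)

lemma dStilde_dStilde:
  assumes X: "finite X" and c: "c \<in> carr (Stilde_obj P (Suc (Suc a)) X)"
  shows "dStilde P a X (dStilde P (Suc a) X c) = mzero (Stilde_obj P a X)"
proof (rule Stilde_obj_coef_eqI[OF X])
  note dc = rlinear_closed[OF rlinear_dStilde[OF premod X] c]
  show "dStilde P a X (dStilde P (Suc a) X c) \<in> carr (Stilde_obj P a X)"
    by (rule rlinear_closed[OF rlinear_dStilde[OF premod X] dc])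
  show "mzero (Stilde_obj P a X) \<in> carr (Stilde_obj P a X)"
    by (rule rmod_zero_closed[OF is_rmod_Stilde_obj[OF premod X]])
  fix I k
  assume I: "I \<subseteq> X" "card I = a"
  have "coef (X - I) (dStilde P a X (dStilde P (Suc a) X c) I) k =
    (\<Sum>i\<in>X - I. psign i I * (\<Sum>j\<in>X - insert i I. psign j (insert i I) *
      coef (X - insert j (insert i I)) (c (insert j (insert i I))) k))"
    unfolding coef_dStilde[OF X dc I]
    by (intro sum.cong refl arg_cong2[where f = times] coef_dStilde[OF X c] index_insert(1,2)[OF X I])
  also have "\<dots> = 0"
    using psign_sum_sum_eq_zero[OF X I(1), where F = "\<lambda>J. coef (X - J) (c J) k"] .
  finally show "coef (X - I) (dStilde P a X (dStilde P (Suc a) X c) I) k =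
      coef (X - I) (mzero (Stilde_obj P a X) I) k"
    using X I by (simp add: Stilde_obj_apply coef_zero)
qed

text \<open>For a fixed basis element \<open>(b, \<alpha>)\<close> the complex is the augmented chain complex of the
  simplex on $X \setminus \alpha(\deg b)$; coning off its least vertex is a contracting homotopy.\<close>
lemma dStilde_exact:
  assumes X: "finite X" and c: "c \<in> carr (Stilde_obj P (Suc a) X)"
    and dc: "dStilde P a X c = mzero (Stilde_obj P a X)"
  shows "c \<in> dStilde P (Suc a) X ` carr (Stilde_obj P (Suc (Suc a)) X)"
proof -
  \<comment> \<open>The vertices of the simplex belonging to k: its injection lands in X - I exactly
    when I is contained in \<open>W k\<close>, as \<open>keys\<close> below records.\<close>
  define W :: "'p \<times> (nat \<Rightarrow> nat) \<Rightarrow> nat set" where "W k = X - snd k ` deg (fst k)" for k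
  define C where "C I k = coef (X - I) (c I) k" for I k
  \<comment> \<open>The homotopy adjoins the least vertex m of \<open>W k\<close>: at sets with
    least element m it takes the value of C after deleting m. The minus compensates for the sign -1
    of a least index in the differential. The condition on k keeps I inside
    \<open>W k\<close>.\<close>
  define E where "E I k = (if k \<in> keys (X - I) \<and> Min I = Min (W k) then - C (I - {Min I}) k else 0)" for I k
  have keys: "k \<in> keys (X - I) \<longleftrightarrow> k \<in> keys X \<and> I \<subseteq> W k" if "I \<subseteq> X" for I k
    using that by (cases k) (fastforce simp: keys_def fi_homs_def W_def image_subset_iff)
  have finI: "finite I" if "I \<subseteq> X" for I
    using that X finite_subset by blast
  have C0: "C I k = 0" if "I \<subseteq> X" "card I = Suc a" "k \<notin> keys (X - I)" for I k
    unfolding C_def using coef_support[OF _ Stilde_obj_closed[OF c that(1,2)] that(3)] X by simp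
  have Cfin: "finite {k. C I k \<noteq> 0}" if "I \<subseteq> X" "card I = Suc a" for I
    unfolding C_def using coef_in[OF _ Stilde_obj_closed[OF c that]] X by (simp add: coefs_def)
  have Csum: "(\<Sum>i\<in>X - I. psign i I * C (insert i I) k) = 0" if "I \<subseteq> X" "card I = a" for I k
    unfolding C_def coef_dStilde[OF X c that, symmetric] dc
    using that X by (simp add: Stilde_obj_apply coef_zero)
  have drop: "I - {Min I} \<subseteq> X" "card (I - {Min I}) = Suc a" if "I \<subseteq> X" "card I = Suc (Suc a)" for I
  proof -
    have "Min I \<in> I"
      using that finI[of I] by (intro Min_in) auto
    then show "I - {Min I} \<subseteq> X" "card (I - {Min I}) = Suc a"
      using that finI[of I] by auto
  qed
  have E: "E I \<in> coefs (X - I)" if "I \<subseteq> X" "card I = Suc (Suc a)" for I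
  proof -
    have "{k. E I k \<noteq> 0} \<subseteq> {k. C (I - {Min I}) k \<noteq> 0}" "{k. E I k \<noteq> 0} \<subseteq> keys (X - I)"
      by (auto simp: E_def split: if_splits)
    then show ?thesis
      using Cfin[OF drop[OF that]] finite_subset by (auto simp: coefs_def)
  qed
  define e where "e I = (if I \<subseteq> X \<and> card I = Suc (Suc a) then comb (X - I) (E I) else undefined)" for I
  have e: "e \<in> carr (Stilde_obj P (Suc (Suc a)) X)"
    using comb_closed[OF finite_Diff[OF X] E] by (auto simp: Stilde_obj_carr e_def)
  have coef_e: "coef (X - I) (e I) = E I" if "I \<subseteq> X" "card I = Suc (Suc a)" for I
    using that coef_eqI[OF finite_Diff[OF X] E[OF that]] by (simp add: e_def)
  have main: "(\<Sum>i\<in>X - I. psign i I * E (insert i I) k) = C I k" if I: "I \<subseteq> X" "card I = Suc a" for I k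
  proof (cases "k \<in> keys (X - I)")
    case False
    then have "E (insert i I) k = 0" if "i \<in> X - I" for i
      using that I keys[of I] keys[of "insert i I"] by (auto simp: E_def)
    then show ?thesis
      using C0[OF I False] by simp
  next
    case True
    then have k: "k \<in> keys X" and IW: "I \<subseteq> W k"
      using keys[OF I(1)] by auto
    have Wfin: "finite (W k)" and WX: "W k \<subseteq> X"
      using X by (auto simp: W_def)
    \<comment> \<open>Positive degree enters here: a nonempty I inside \<open>W k\<close> guarantees
      a vertex to cone from. In degree zero \<open>W k\<close> may be empty, and those keys carry
      the homology.\<close>
    have "I \<noteq> {}"
      using I by auto
    then have Wne: "W k \<noteq> {}"
      using IW by auto
    define m where "m = Min (W k)"
    have mW: "m \<in> W k" and mle: "\<And>i. i \<in> W k \<Longrightarrow> m \<le> i"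
      using Wfin Wne by (auto simp: m_def)
    note If = finI[OF I(1)]
    show ?thesis
    proof (cases "m \<in> I")
      case mI: True
      define I' where "I' = I - {m}"
      have I': "I' \<subseteq> X" "card I' = a" "insert m I' = I" "m \<notin> I'" "finite I'"
        using I mI If by (auto simp: I'_def)
      \<comment> \<open>As m < i, deleting m from I flips the sign of i, which cancels the minus in
        E. For i outside \<open>W k\<close> both sides vanish.\<close>
      have step: "psign i I * E (insert i I) k = psign i I' * C (insert i I') k" if i: "i \<in> X - I" for i
      proof (cases "i \<in> W k")
        case True
        have iI': "i \<notin> I'" "i \<noteq> m"
          using i mI by (auto simp: I'_def)
        have Min: "Min (insert i I) = m"
          using If mI mle IW True by (intro Min_eqI) auto
        have "insert i I - {m} = insert i I'"
          using iI' by (auto simp: I'_def)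
        then have "E (insert i I) k = - C (insert i I') k"
          using keys[of "insert i I"] k IW True i I Min by (simp add: E_def m_def)
        moreover have "psign i I = (- psign i I' :: 'r)"
          using psign_insert[OF I'(5,4) iI'(1) iI'(2)[symmetric], where ?'r = 'r] mle[OF True] iI'(2) I'(3)
          by simp
        ultimately show ?thesis
          by simp
      next
        case False
        then have "E (insert i I) k = 0" "C (insert i I') k = 0"
          using keys[of "insert i I"] keys[of "insert i I'"] i I I'
            C0[of "insert i I'" k] index_insert[OF X I'(1,2), of i]
          by (auto simp: E_def I'_def)
        then show ?thesis
          by simp
      qed
      have "X - I' = insert m (X - I)" "m \<notin> X - I"
        using mW WX mI by (auto simp: I'_def)
      \<comment> \<open>The cycle condition for c at I', with the term i = m split off.\<close>
      then have "psign m I' * C I k + (\<Sum>i\<in>X - I. psign i I' * C (insert i I') k) = 0"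
        using Csum[OF I'(1,2), of k] X I'(3) by simp
      moreover have "psign m I' = (- 1 :: 'r)"
      proof -
        have none: "{j \<in> I'. j < m} = {}"
          using mle IW by (force simp: I'_def)
        show ?thesis
          unfolding psign_alt[OF I'(5,4)] none by simp
      qed
      ultimately show ?thesis
        using step by simp
    next
      case mI: False
      \<comment> \<open>Here m is not in insert i I, so it cannot be its minimum; only i = m
        contributes.\<close>
      have other: "psign i I * E (insert i I) k = 0" if i: "i \<in> X - I" "i \<noteq> m" for i
      proof -
        have "Min (insert i I) \<in> insert i I"
          using If by (intro Min_in) auto
        then have "Min (insert i I) \<noteq> Min (W k)"
          using mI i(2) by (auto simp: m_def)
        then show ?thesis
          by (simp add: E_def)
      qed
      have mX: "m \<in> X - I"
        using mI mW WX by auto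
      have Min: "Min (insert m I) = m"
        using If mle IW by (intro Min_eqI) auto
      have E: "E (insert m I) k = - C I k"
        using keys[of "insert m I"] k IW mW mX I mI Min by (simp add: E_def m_def)
      have none: "{j \<in> I. j < m} = {}"
        using mle IW by (force simp: not_less)
      have "(\<Sum>i\<in>X - I. psign i I * E (insert i I) k) = psign m I * E (insert m I) k"
        using X mX other by (subst sum.remove[of _ m]) (auto intro!: sum.neutral)
      then show ?thesis
        unfolding psign_alt[OF If mI] none E by simp
    qed
  qed
  have "c = dStilde P (Suc a) X e"
  proof (rule Stilde_obj_coef_eqI[OF X c])
    show "dStilde P (Suc a) X e \<in> carr (Stilde_obj P (Suc a) X)"
      by (rule rlinear_closed[OF rlinear_dStilde[OF premod X] e])
    fix I k
    assume I: "I \<subseteq> X" "card I = Suc a"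
    have "coef (X - I) (dStilde P (Suc a) X e I) k = (\<Sum>i\<in>X - I. psign i I * E (insert i I) k)"
      unfolding coef_dStilde[OF X e I]
      by (intro sum.cong refl) (simp add: coef_e[OF index_insert(1,2)[OF X I]])
    then show "coef (X - I) (c I) k = coef (X - I) (dStilde P (Suc a) X e I) k"
      using main[OF I] by (simp add: C_def)
  qed
  then show ?thesis
    using e by blast
qed

end

lemma free_dStilde_exact:
  assumes P: "is_fimod P" "is_free_fimod P" and X: "finite X"
  shows "{c \<in> carr (Stilde_obj P (Suc a) X). dStilde P a X c = mzero (Stilde_obj P a X)}
    = dStilde P (Suc a) X ` carr (Stilde_obj P (Suc (Suc a)) X)"
proof -
  have "\<exists>B deg. fi_basis P B deg"
    using P(2) unfolding is_free_fimod_def fi_basis_def by (simp only: P(1) simp_thms)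
  then obtain B deg where "fi_basis P B deg"
    by (elim exE)
  then interpret fi_basis P B deg .
  show ?thesis
    using dStilde_exact[OF X] dStilde_dStilde[OF X] rlinear_closed[OF rlinear_dStilde[OF premod X]]
    by blast
qed

subsection \<open>The cokernel of the differential in degree zero\<close>

lemma rspan_base: "G \<subseteq> rspan M G"
  by (auto simp: rspan_def)

lemma rspan_minimal: "rsubmod M S \<Longrightarrow> G \<subseteq> S \<Longrightarrow> rspan M G \<subseteq> S"
  by (auto simp: rspan_def)

lemma rsubmod_rspan:
  assumes "is_rmod M" "G \<subseteq> carr M"
  shows "rsubmod M (rspan M G)"
  using rspan_minimal[OF rsubmod_carr[OF assms(1)] assms(2)]
  unfolding rsubmod_def[of M "rspan M G"]
proof (intro conjI ballI allI)
  show "mzero M \<in> rspan M G"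
    unfolding rspan_def using rsubmod_zero by blast
  show "madd M x y \<in> rspan M G" if "x \<in> rspan M G" "y \<in> rspan M G" for x y
    using that unfolding rspan_def by (simp add: rsubmod_add)
  show "msmul M r x \<in> rspan M G" if "x \<in> rspan M G" for r x
    using that unfolding rspan_def by (simp add: rsubmod_smul)
qed

lemma fi_premodule_mor_closed: "fi_premodule V \<Longrightarrow> fi_inj X Y \<alpha> \<Longrightarrow> v \<in> carr (fobj V X) \<Longrightarrow>
    fmor V X Y \<alpha> v \<in> carr (fobj V Y)"
  by (rule rlinear_closed[OF fi_premodule_mor])

lemma rlinear_dStilde_eval:
  assumes V: "fi_premodule V" and X: "finite X"
  shows "rlinear (Stilde_obj V 1 X) (fobj V X) (\<lambda>c. dStilde V 0 X c {})"
proof -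
  have "c {} \<in> carr (fobj V X)" if "c \<in> carr (Stilde_obj V 0 X)" for c
    using Stilde_obj_closed[OF that, of "{}"] by simp
  then show ?thesis
    using rlinear_dStilde[OF V X, of 0] by (simp add: rlinear_def Stilde_obj_apply)
qed

text \<open>An injection from a smaller set misses some i in X and therefore factors through the
  inclusion of X - {i}. Conversely these inclusions start at smaller sets. So the inclusions
  omitting one point already generate J V, and they are what the differential from degree one sums
  over.\<close>

lemma Jsub_eq:
  fixes V :: "('r::comm_ring_1, 'v) fimod"
  assumes V: "is_fimod V" and X: "finite X"
  shows "Jsub V X = (\<lambda>c. dStilde V 0 X c {}) ` carr (Stilde_obj V 1 X)"
proof
  note V' = is_fimod_premodule[OF V]
  note M = fi_premodule_rmod[OF V' X]
  let ?G = "\<Union>{fmor V Y X \<alpha> ` carr (fobj V Y) | Y \<alpha>. fi_inj Y X \<alpha> \<and> card Y < card X}"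
  let ?D = "(\<lambda>c. dStilde V 0 X c {}) ` carr (Stilde_obj V 1 X)"
  have G: "?G \<subseteq> carr (fobj V X)"
    using fi_premodule_mor_closed[OF V'] by blast
  have lin: "rlinear (Stilde_obj V 1 X) (fobj V X) (\<lambda>c. dStilde V 0 X c {})"
    by (rule rlinear_dStilde_eval[OF V' X])
  have "?G \<subseteq> ?D"
  proof
    fix x
    assume "x \<in> ?G"
    then obtain Y \<alpha> v where \<alpha>: "fi_inj Y X \<alpha>" "card Y < card X" and v: "v \<in> carr (fobj V Y)"
      and x: "x = fmor V Y X \<alpha> v"
      by auto
    have Y: "finite Y"
      using fi_inj_finite[OF \<alpha>(1)] by blast
    have "\<alpha> ` Y \<noteq> X"
      using \<alpha>(2) card_image_le[OF Y, of \<alpha>] by auto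
    then obtain i where i: "i \<in> X" "i \<notin> \<alpha> ` Y"
      using \<alpha>(1) by (auto simp: fi_inj_def)
    have \<alpha>': "fi_inj Y (X - {i}) \<alpha>"
      using \<alpha>(1) i by (auto simp: fi_inj_def)
    define w where "w = fmor V Y (X - {i}) \<alpha> v"
    have w: "w \<in> carr (fobj V (X - {i}))"
      unfolding w_def by (rule fi_premodule_mor_closed[OF V' \<alpha>' v])
    have incl: "fi_inj (X - {j}) X id" for j
      using X by (auto intro: fi_inj_id)
    have xw: "fmor V (X - {i}) X id w = x"
      unfolding w_def x using fimod_comp[OF V \<alpha>' incl v] by simp
    \<comment> \<open>The cochain supported at {i}. The coefficient -1 cancels the sign of the
      differential, i having position one in {i}.\<close>
    define c where "c I = (if I = {i} then msmul (fobj V (X - {i})) (- 1) w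
      else if I \<subseteq> X \<and> card I = 1 then mzero (fobj V (X - I)) else undefined)" for I
    note M' = fi_premodule_rmod[OF V' finite_Diff[OF X]]
    have c: "c \<in> carr (Stilde_obj V 1 X)"
      using w i by (auto simp: Stilde_obj_carr c_def rmod_closed M')
    have "psign i {} = (- 1 :: 'r)"
      by (simp add: psign_alt)
    moreover have "fmor V (X - {i}) X id (msmul (fobj V (X - {i})) (- 1) w) = msmul (fobj V X) (- 1) x"
      using rlinear_smul[OF fi_premodule_mor[OF V' incl] w] xw by simp
    moreover have xM: "x \<in> carr (fobj V X)"
      using fi_premodule_mor_closed[OF V' incl w] xw by simp
    ultimately have ti: "dterm V X c {} i = x"
      by (simp add: dterm_def c_def rmod_smul_smul M rmod_one_smul)
    have "dterm V X c {} j = mzero (fobj V X)" if "j \<in> X - {i}" for j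
      using that rlinear_zero[OF M' M fi_premodule_mor[OF V' incl]]
      by (simp add: dterm_def c_def rmod_smul_zero M)
    then have "dStilde V 0 X c {} = x"
      using msum_single[OF M X i(1), of "dterm V X c {}"] ti xM by (simp add: dStilde_apply)
    then show "x \<in> ?D"
      using c by blast
  qed
  then show "Jsub V X \<subseteq> ?D"
    unfolding Jsub_def
    by (intro rspan_minimal rsubmod_image is_rmod_Stilde_obj[OF V' X] M lin)
  show "?D \<subseteq> Jsub V X"
  proof
    fix x
    assume "x \<in> ?D"
    then obtain c where c: "c \<in> carr (Stilde_obj V (Suc 0) X)" and x: "x = dStilde V 0 X c {}"
      by auto
    note J = rsubmod_rspan[OF M G, folded Jsub_def]
    have "dterm V X c {} i \<in> Jsub V X" if i: "i \<in> X" for i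
    proof -
      have "c {i} \<in> carr (fobj V (X - {i}))"
        using Stilde_obj_closed[OF c, of "{i}"] i by simp
      moreover have "fi_inj (X - {i}) X id" "card (X - {i}) < card X"
        using X i card_Diff1_less[OF X i] by (auto intro: fi_inj_id)
      ultimately have "fmor V (X - {i}) X id (c {i}) \<in> ?G"
        by (intro UnionI[OF _ imageI]) auto
      then have "fmor V (X - {i}) X id (c {i}) \<in> Jsub V X"
        unfolding Jsub_def by (rule subsetD[OF rspan_base])
      then show ?thesis
        using rsubmod_smul[OF J] by (simp add: dterm_def)
    qed
    then show "x \<in> Jsub V X"
      unfolding x using msum_rsubmod[OF M J X] by (simp add: dStilde_apply)
  qed
qed

text \<open>\<open>card\<close> is zero on infinite sets as well; finiteness of X excludes them as
  indices.\<close>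

lemma index_zero_iff: "finite X \<Longrightarrow> I \<subseteq> X \<and> card I = 0 \<longleftrightarrow> I = {}"
  using finite_subset[of I X] by auto

lemma carr_Stilde_obj_zero: "finite X \<Longrightarrow> c \<in> carr (Stilde_obj V 0 X) \<longleftrightarrow>
    c {} \<in> carr (fobj V X) \<and> (\<forall>I. I \<noteq> {} \<longrightarrow> c I = undefined)"
  unfolding Stilde_obj_carr index_zero_iff by auto

text \<open>An element of degree zero is determined by its value at the empty set, being
  \<open>undefined\<close> elsewhere. Agreement there with a boundary is thus equality with
  it.\<close>

lemma eval_empty_iff_Jsub:
  assumes V: "is_fimod V" and X: "finite X" and c: "c \<in> carr (Stilde_obj V 0 X)"
  shows "c {} \<in> Jsub V X \<longleftrightarrow> c \<in> dStilde V 0 X ` carr (Stilde_obj V 1 X)"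
proof -
  have "c = dStilde V 0 X b" if "b \<in> carr (Stilde_obj V 1 X)" "c {} = dStilde V 0 X b {}" for b
  proof (rule Stilde_obj_eqI[of X 0])
    show "c I = dStilde V 0 X b I" if "I \<subseteq> X" "card I = 0" for I
      using \<open>c {} = dStilde V 0 X b {}\<close> that index_zero_iff[OF X, of I] by auto
  qed (use c in \<open>auto simp: Stilde_obj_carr dStilde_undefined\<close>)
  then show ?thesis
    unfolding Jsub_eq[OF V X] by blast
qed

lemma Stilde_mor_zero_eval: "fi_inj X Y \<alpha> \<Longrightarrow> fi_premodule V \<Longrightarrow> c {} \<in> carr (fobj V X) \<Longrightarrow>
    Stilde_mor V 0 X Y \<alpha> c {} = fmor V X Y \<alpha> (c {})"
  using Stilde_mor_image[of X Y \<alpha> "{}" 0 V c] fi_premodule_mor_closed[of V X Y \<alpha> "c {}"]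
    fi_premodule_rmod[of V Y] fi_inj_finite[of X Y \<alpha>]
  by (simp add: wsign_def rmod_one_smul)

lemma ex_Stilde_obj_zero: "finite X \<Longrightarrow> v \<in> carr (fobj V X) \<Longrightarrow>
    \<exists>c\<in>carr (Stilde_obj V 0 X). c {} = v"
  by (rule bexI[of _ "\<lambda>I. if I = {} then v else undefined"]) (simp_all add: carr_Stilde_obj_zero)

lemma Jsub_eq_eval:
  assumes "is_fimod V" "finite X"
  shows "Jsub V X = (\<lambda>c. c {}) ` (dStilde V 0 X ` carr (Stilde_obj V 1 X))"
  by (simp add: Jsub_eq[OF assms] image_image)

text \<open>Up to evaluation at the empty set, J V is the image of the morphism
  \<open>dStilde V 0\<close>, so stability comes from its naturality and no span has to be
  transported.\<close>

lemma fi_stable_Jsub: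
  assumes V: "is_fimod V"
  shows "fi_stable V (Jsub V)"
proof -
  note V' = is_fimod_premodule[OF V]
  have "fi_stable (Stilde V 0) (\<lambda>X. dStilde V 0 X ` carr (fobj (Stilde V 1) X))"
    using fi_stable_image[OF fi_premodule_Stilde[OF V'] fi_premodule_Stilde[OF V'] fi_hom_dStilde[OF V]]
    by simp
  note st = this[unfolded Stilde_simps]
  show ?thesis
    unfolding fi_stable_def
  proof (intro conjI allI impI)
    fix X :: "nat set"
    assume X: "finite X"
    have "rlinear (Stilde_obj V 1 X) (fobj V X) (\<lambda>c. dStilde V 0 X c {})"
      by (rule rlinear_dStilde_eval[OF V' X])
    then show "rsubmod (fobj V X) (Jsub V X)"
      unfolding Jsub_eq[OF V X]
      by (intro rsubmod_image is_rmod_Stilde_obj[OF V' X] fi_premodule_rmod[OF V' X])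
  next
    fix X Y \<alpha>
    assume \<alpha>: "fi_inj X Y \<alpha>"
    then have XY: "finite X" "finite Y"
      by (auto dest: fi_inj_finite)
    have "fmor V X Y \<alpha> (c {}) \<in> Jsub V Y" if c: "c \<in> dStilde V 0 X ` carr (Stilde_obj V 1 X)" for c
    proof -
      have "c {} \<in> carr (fobj V X)"
        using c rlinear_closed[OF rlinear_dStilde[OF V' XY(1), of 0]]
        by (auto simp: carr_Stilde_obj_zero[OF XY(1)])
      moreover have "Stilde_mor V 0 X Y \<alpha> c \<in> dStilde V 0 Y ` carr (Stilde_obj V 1 Y)"
        using fi_stable_mor[OF st] c \<alpha> by fastforce
      ultimately show ?thesis
        unfolding Jsub_eq_eval[OF V XY(2)] using Stilde_mor_zero_eval[OF \<alpha> V'] by (metis imageI)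
    qed
    then show "fmor V X Y \<alpha> ` Jsub V X \<subseteq> Jsub V Y"
      unfolding Jsub_eq_eval[OF V XY(1)] by blast
  qed
qed

text \<open>Again J V is treated as an image of the differential, which commutes with
  \<open>Smap f\<close>.\<close>

lemma fi_hom_Jsub:
  assumes V: "is_fimod V" and W: "is_fimod W" and f: "fi_hom V W f" and X: "finite X"
  shows "f X ` Jsub V X \<subseteq> Jsub W X"
proof -
  note V' = is_fimod_premodule[OF V] and W' = is_fimod_premodule[OF W]
  have "f X (dStilde V 0 X b {}) \<in> Jsub W X" if b: "b \<in> carr (Stilde_obj V (Suc 0) X)" for b
  proof -
    have "f X (dStilde V 0 X b {}) = dStilde W 0 X (Smap f (Suc 0) X b) {}"
      unfolding dStilde_Smap[OF V' W' f X b] by (simp add: Smap_def)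
    moreover have "Smap f (Suc 0) X b \<in> carr (Stilde_obj W (Suc 0) X)"
      using rlinear_closed[OF fi_hom_linear[OF fi_hom_Smap[OF V' W' f] X, unfolded Stilde_simps] b] .
    ultimately show ?thesis
      unfolding Jsub_eq[OF W X] by auto
  qed
  then show ?thesis
    unfolding Jsub_eq[OF V X] by auto
qed

section \<open>The quotient by J V as augmentation of the columns\<close>

lemma fi_coinv_simps [simp]:
  "fobj (fi_coinv V) X = rquot (fobj V X) (Jsub V X)"
  "fmor (fi_coinv V) X Y \<alpha> = qmap (fobj V Y) (Jsub V Y) (fmor V X Y \<alpha>)"
  by (simp_all add: fi_coinv_def fi_quot_def)

lemma fi_premodule_coinv:
  assumes V: "is_fimod V"
  shows "fi_premodule (fi_coinv V)"
  unfolding fi_premodule_def fi_coinv_simps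
proof (intro conjI allI impI)
  note M = fi_premodule_rmod[OF is_fimod_premodule[OF V]] fi_stable_rsubmod[OF fi_stable_Jsub[OF V]]
  show "is_rmod (rquot (fobj V X) (Jsub V X))" if "finite X" for X
    by (rule is_rmod_rquot[OF M[OF that]])
  show "rlinear (rquot (fobj V X) (Jsub V X)) (rquot (fobj V Y) (Jsub V Y))
      (qmap (fobj V Y) (Jsub V Y) (fmor V X Y \<alpha>))" if \<alpha>: "fi_inj X Y \<alpha>" for X Y \<alpha>
    using fi_inj_finite[OF \<alpha>]
    by (intro rlinear_qmap M fi_premodule_mor[OF is_fimod_premodule[OF V] \<alpha>]
        fi_stable_mor[OF fi_stable_Jsub[OF V] \<alpha>]) simp_all
qed

lemma fi_hom_coinv:
  assumes V: "is_fimod V" and W: "is_fimod W" and f: "fi_hom V W f"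
  shows "fi_hom (fi_coinv V) (fi_coinv W) (fi_coinv_map W f)"
proof -
  note MV = fi_premodule_rmod[OF is_fimod_premodule[OF V]] fi_stable_rsubmod[OF fi_stable_Jsub[OF V]]
  note MW = fi_premodule_rmod[OF is_fimod_premodule[OF W]] fi_stable_rsubmod[OF fi_stable_Jsub[OF W]]
  show ?thesis
    unfolding fi_hom_def fi_coinv_simps fi_coinv_map_def rquot_carr
  proof (intro conjI allI impI ballI)
    show "rlinear (rquot (fobj V X) (Jsub V X)) (rquot (fobj W X) (Jsub W X)) (qmap (fobj W X) (Jsub W X) (f X))"
      if "finite X" for X
      using that by (intro rlinear_qmap MV MW fi_hom_linear[OF f] fi_hom_Jsub[OF V W f])
  next
    fix X Y \<alpha> A
    assume \<alpha>: "fi_inj X Y \<alpha>" and "A \<in> rcoset (fobj V X) (Jsub V X) ` carr (fobj V X)"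
    then obtain v where v: "v \<in> carr (fobj V X)" and A: "A = rcoset (fobj V X) (Jsub V X) v"
      by blast
    have X: "finite X" and Y: "finite Y"
      using fi_inj_finite[OF \<alpha>] by auto
    note linV = fi_premodule_mor[OF is_fimod_premodule[OF V] \<alpha>]
      and linW = fi_premodule_mor[OF is_fimod_premodule[OF W] \<alpha>]
    show "qmap (fobj W Y) (Jsub W Y) (f Y) (qmap (fobj V Y) (Jsub V Y) (fmor V X Y \<alpha>) A) =
        qmap (fobj W Y) (Jsub W Y) (fmor W X Y \<alpha>) (qmap (fobj W X) (Jsub W X) (f X) A)"
      unfolding A
        qmap_rcoset[OF MV[OF X] MV[OF Y] linV fi_stable_mor[OF fi_stable_Jsub[OF V] \<alpha>] v]
        qmap_rcoset[OF MV[OF X] MW[OF X] fi_hom_linear[OF f X] fi_hom_Jsub[OF V W f X] v]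
        qmap_rcoset[OF MV[OF Y] MW[OF Y] fi_hom_linear[OF f Y] fi_hom_Jsub[OF V W f Y]
          rlinear_closed[OF linV v]]
        qmap_rcoset[OF MW[OF X] MW[OF Y] linW fi_stable_mor[OF fi_stable_Jsub[OF W] \<alpha>]
          rlinear_closed[OF fi_hom_linear[OF f X] v]]
        fi_hom_natural[OF f \<alpha> v] by (rule refl)
  qed
qed

text \<open>Evaluation at the empty set identifies the degree zero term of the complex with V; under
  it this is the projection of V onto V/JV.\<close>

definition coinv_proj :: "('r::comm_ring_1, 'v) fimod \<Rightarrow> nat set \<Rightarrow> (nat set \<Rightarrow> 'v) \<Rightarrow> 'v set" where
  "coinv_proj V X c = rcoset (fobj V X) (Jsub V X) (c {})"

lemma fi_hom_coinv_proj:
  assumes V: "is_fimod V"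
  shows "fi_hom (Stilde V 0) (fi_coinv V) (coinv_proj V)"
proof -
  note M = fi_premodule_rmod[OF is_fimod_premodule[OF V]] fi_stable_rsubmod[OF fi_stable_Jsub[OF V]]
  show ?thesis
    unfolding fi_hom_def Stilde_simps fi_coinv_simps coinv_proj_def
  proof (intro conjI allI impI ballI)
    fix X :: "nat set"
    assume X: "finite X"
    show "rlinear (Stilde_obj V 0 X) (rquot (fobj V X) (Jsub V X)) (\<lambda>c. rcoset (fobj V X) (Jsub V X) (c {}))"
      using rlinear_rcoset[OF M[OF X]]
      by (auto simp: rlinear_def carr_Stilde_obj_zero[OF X] Stilde_obj_apply)
  next
    fix X Y \<alpha> c
    assume \<alpha>: "fi_inj X Y \<alpha>" and c: "c \<in> carr (Stilde_obj V 0 X)"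
    have X: "finite X" and Y: "finite Y"
      using fi_inj_finite[OF \<alpha>] by auto
    have c0: "c {} \<in> carr (fobj V X)"
      using c by (simp add: carr_Stilde_obj_zero[OF X])
    show "rcoset (fobj V Y) (Jsub V Y) (Stilde_mor V 0 X Y \<alpha> c {}) =
        qmap (fobj V Y) (Jsub V Y) (fmor V X Y \<alpha>) (rcoset (fobj V X) (Jsub V X) (c {}))"
      unfolding Stilde_mor_zero_eval[OF \<alpha> is_fimod_premodule[OF V], of c, OF c0]
        qmap_rcoset[OF M[OF X] M[OF Y] fi_premodule_mor[OF is_fimod_premodule[OF V] \<alpha>]
          fi_stable_mor[OF fi_stable_Jsub[OF V] \<alpha>] c0] by (rule refl)
  qed
qed

section \<open>The double complex of a free resolution\<close>

theorem theorem1p1: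
  fixes V :: "('r::comm_ring_1, 'v) fimod"
    and P :: "nat \<Rightarrow> ('r, 'p) fimod"
    and dP :: "nat \<Rightarrow> nat set \<Rightarrow> 'p \<Rightarrow> 'p"
    and eps :: "nat set \<Rightarrow> 'p \<Rightarrow> 'v"
    and a :: nat
  assumes "is_fimod V"
    and "fi_free_resolution V P dP eps"
  shows "fi_isomorphic (FI_homology P dP a) (fi_homology (Stilde V) (dStilde V) a)"
proof -
  have P: "is_fimod (P j)" "is_free_fimod (P j)" and dP: "fi_hom (P (Suc j)) (P j) (dP j)"
    and eps: "fi_hom (P 0) V eps" for j
    using assms(2) by (auto simp: fi_free_resolution_def)
  have eps_surj: "eps X ` carr (fobj (P 0) X) = carr (fobj V X)"
    and eps_ker: "{x \<in> carr (fobj (P 0) X). eps X x = mzero (fobj V X)} = dP 0 X ` carr (fobj (P 1) X)"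
    and dP_exact: "{x \<in> carr (fobj (P (Suc j)) X). dP j X x = mzero (fobj (P j) X)}
      = dP (Suc j) X ` carr (fobj (P (Suc (Suc j))) X)" if "finite X" for X j
    using assms(2) that by (auto simp: fi_free_resolution_def)
  note pre = is_fimod_premodule[OF P(1)] is_fimod_premodule[OF assms(1)]
  \<comment> \<open>The first index is the degree in the complex of an FI-module, the second that in
    the resolution. Freeness is used for exactness in the first direction, exactness of the
    resolution at each X - I for the second.\<close>
  interpret exact_double_complex "\<lambda>i j. Stilde (P j) i" "\<lambda>i j. dStilde (P j) i" "\<lambda>i j. Smap (dP j) i"
  proof
    fix i j and X :: "nat set"
    show "fi_premodule (Stilde (P j) i)"
      by (rule fi_premodule_Stilde[OF pre(1)])
    show "fi_hom (Stilde (P j) (Suc i)) (Stilde (P j) i) (dStilde (P j) i)"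
      by (rule fi_hom_dStilde[OF P(1)])
    show "fi_hom (Stilde (P (Suc j)) i) (Stilde (P j) i) (Smap (dP j) i)"
      by (rule fi_hom_Smap[OF pre(1) pre(1) dP])
    assume X: "finite X"
    show "dStilde (P j) i X (Smap (dP j) (Suc i) X x) = Smap (dP j) i X (dStilde (P (Suc j)) i X x)"
      if "x \<in> carr (fobj (Stilde (P (Suc j)) (Suc i)) X)" for x
      using dStilde_Smap[OF pre(1) pre(1) dP X] that by simp
    show "{x \<in> carr (fobj (Stilde (P j) (Suc i)) X). dStilde (P j) i X x = mzero (fobj (Stilde (P j) i) X)}
        = dStilde (P j) (Suc i) X ` carr (fobj (Stilde (P j) (Suc (Suc i))) X)"
      unfolding Stilde_simps by (rule free_dStilde_exact[OF P X])
    show "{x \<in> carr (fobj (Stilde (P (Suc j)) i) X). Smap (dP j) i X x = mzero (fobj (Stilde (P j) i) X)}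
        = Smap (dP (Suc j)) i X ` carr (fobj (Stilde (P (Suc (Suc j))) i) X)"
      unfolding Stilde_simps by (rule Smap_exact[OF X dP_exact])
  qed
  have rows: "augmented_double_complex (\<lambda>i j. Stilde (P j) i) (\<lambda>i j. dStilde (P j) i)
      (\<lambda>i j. Smap (dP j) i) (Stilde V) (dStilde V) (Smap eps)"
  proof
    fix i and X :: "nat set"
    show "fi_premodule (Stilde V i)"
      by (rule fi_premodule_Stilde[OF pre(2)])
    show "fi_hom (Stilde V (Suc i)) (Stilde V i) (dStilde V i)"
      by (rule fi_hom_dStilde[OF assms(1)])
    show "fi_hom (Stilde (P 0) i) (Stilde V i) (Smap eps i)"
      by (rule fi_hom_Smap[OF pre eps])
    assume X: "finite X"
    show "Smap eps i X ` carr (fobj (Stilde (P 0) i) X) = carr (fobj (Stilde V i) X)"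
      unfolding Stilde_simps by (rule Smap_surj[OF X eps_surj])
    show "{x \<in> carr (fobj (Stilde (P 0) i) X). Smap eps i X x = mzero (fobj (Stilde V i) X)}
        = Smap (dP 0) i X ` carr (fobj (Stilde (P 1) i) X)"
      unfolding Stilde_simps by (rule Smap_exact[OF X eps_ker])
    show "dStilde V i X (Smap eps (Suc i) X x) = Smap eps i X (dStilde (P 0) i X x)"
      if "x \<in> carr (fobj (Stilde (P 0) (Suc i)) X)" for x
      using dStilde_Smap[OF pre eps X] that by simp
  qed
  \<comment> \<open>Makes the transposed axioms available, so that only the augmentation axioms
    remain to be shown for the columns.\<close>
  interpret T: exact_double_complex "\<lambda>j i. Stilde (P j) i" "\<lambda>j i. Smap (dP j) i" "\<lambda>j i. dStilde (P j) i"
    by (rule transpose)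
  have cols: "augmented_double_complex (\<lambda>j i. Stilde (P j) i) (\<lambda>j i. Smap (dP j) i)
      (\<lambda>j i. dStilde (P j) i) (\<lambda>j. fi_coinv (P j)) (\<lambda>j. fi_coinv_map (P j) (dP j)) (\<lambda>j. coinv_proj (P j))"
  proof
    fix j and X :: "nat set"
    show "fi_premodule (fi_coinv (P j))"
      by (rule fi_premodule_coinv[OF P(1)])
    show "fi_hom (fi_coinv (P (Suc j))) (fi_coinv (P j)) (fi_coinv_map (P j) (dP j))"
      by (rule fi_hom_coinv[OF P(1) P(1) dP])
    show "fi_hom (Stilde (P j) 0) (fi_coinv (P j)) (coinv_proj (P j))"
      by (rule fi_hom_coinv_proj[OF P(1)])
    assume X: "finite X"
    have M: "is_rmod (fobj (P j) X)" "rsubmod (fobj (P j) X) (Jsub (P j) X)" for j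
      using fi_premodule_rmod[OF pre(1) X] fi_stable_rsubmod[OF fi_stable_Jsub[OF P(1)] X] by auto
    show "coinv_proj (P j) X ` carr (fobj (Stilde (P j) 0) X) = carr (fobj (fi_coinv (P j)) X)"
    proof -
      have "(\<lambda>c. c {}) ` carr (Stilde_obj (P j) 0 X) = carr (fobj (P j) X)"
        using ex_Stilde_obj_zero[OF X, of _ "P j"] by (auto simp: carr_Stilde_obj_zero[OF X] image_iff)
      then show ?thesis
        by (simp add: coinv_proj_def[abs_def] rquot_carr image_image flip: \<open>_ = carr (fobj (P j) X)\<close>)
    qed
    show "{x \<in> carr (fobj (Stilde (P j) 0) X). coinv_proj (P j) X x = mzero (fobj (fi_coinv (P j)) X)}
        = dStilde (P j) 0 X ` carr (fobj (Stilde (P j) 1) X)"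
    proof -
      have "coinv_proj (P j) X c = mzero (fobj (fi_coinv (P j)) X) \<longleftrightarrow>
          c \<in> dStilde (P j) 0 X ` carr (Stilde_obj (P j) 1 X)" if c: "c \<in> carr (Stilde_obj (P j) 0 X)" for c
        using eval_empty_iff_Jsub[OF P(1) X c] rcoset_eq_zero_iff[OF M] c
        by (simp add: coinv_proj_def rquot_mzero carr_Stilde_obj_zero[OF X])
      then show ?thesis
        using rlinear_closed[OF rlinear_dStilde[OF pre(1)[of j] X, of 0]] by auto
    qed
    show "fi_coinv_map (P j) (dP j) X (coinv_proj (P (Suc j)) X c) = coinv_proj (P j) X (Smap (dP j) 0 X c)"
      if "c \<in> carr (fobj (Stilde (P (Suc j)) 0) X)" for c
      using that
        qmap_rcoset[OF M M fi_hom_linear[OF dP X] fi_hom_Jsub[OF P(1) P(1) dP X], of "c {}"]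
      by (simp add: fi_coinv_map_def coinv_proj_def Smap_def carr_Stilde_obj_zero[OF X])
  qed
  show ?thesis
    unfolding FI_homology_def by (rule double_complex_homology[OF rows cols])
qed

end
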